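(* Let $r\ge 1$ and $d\ge 2$ be integers. Let $\boldsymbol{\phi}$ be a two-direction multiscaling function of multiplicity $r$ and dilation factor $d$ with real recursion coefficients $P^{+}_k,P^{-}_k\in\mathbb{R}^{r\times r}$, and let $\boldsymbol{\psi}^{(s)}$, $s=1,\dots,d-1$, be two-direction multiwavelets associated with $\boldsymbol{\phi}$ with real recursion coefficients $Q^{(s)+}_k,Q^{(s)-}_k\in\mathbb{R}^{r\times r}$. Assume that $\boldsymbol{\phi}$ is orthogonal, has compact support, is continuous (which implies approximation order at least $1$), and satisfies Condition E. Then the continuous moments $\boldsymbol{m}_j$ of $\boldsymbol{\phi}$ and $\boldsymbol{n}^{(s)}_j$ of $\boldsymbol{\psi}^{(s)}$ can be computed recursively as follows. For $j=0$: $$\boldsymbol{m}_0=M_0\boldsymbol{m}_0,\qquad\text{with normalization}\qquad \boldsymbol{m}_0^*\boldsymbol{m}_0=\frac12 .$$ For $j=1,2,3,\dots$: the matrix $d^jI_r-[M^+_0+(-1)^jM^-_0]$ is invertible and $$\boldsymbol{m}_j=\left(d^jI_r-\left[M^+_0+(-1)^jM^-_0\right]\right)^{-1}\sum_{\ell=0}^{j-1}\binom{j}{\ell}\left[M^+_{j-\ell}+(-1)^\ell M^-_{j-\ell}\right]\boldsymbol{m}_\ell .$$ For $j=0,1,2,\dots$ and $s=1,\dots,d-1$: $$\boldsymbol{n}^{(s)}_j=d^{-j}\sum_{\ell=0}^{j}\binom{j}{\ell}\left[N^{(s)+}_{j-\ell}+(-1)^\ell N^{(s)-}_{j-\ell}\right]\boldsymbol{m}_\ell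 .$$ Here $I_r$ is the $r\times r$ identity matrix. Once $\boldsymbol{m}_0$ has been chosen, all other continuous moments are uniquely defined and are computed recursively from the last two formulas.
   Context: A two-direction multiscaling function of multiplicity $r$ and dilation factor $d$ is a vector $\boldsymbol{\phi}=[\phi_1,\dots,\phi_r]^T$ of real- or complex-valued functions on $\mathbb{R}$ satisfying $$\boldsymbol{\phi}(x)=\sqrt d\sum_{k\in\mathbb{Z}}\left[P^+_k\boldsymbol{\phi}(dx-k)+P^-_k\boldsymbol{\phi}(k-dx)\right]$$ and generating a multiresolution approximation of $L^2(\mathbb{R})$ (in the usual sense, the level-$j$ space being spanned by all $\boldsymbol{\phi}(d^jx-k)$ and $\boldsymbol{\phi}(k-d^jx)$, $k\in\mathbb{Z}$). Two-direction multiwavelets $\boldsymbol{\psi}^{(s)}$, $s=1,\dots,d-1$, associated with $\boldsymbol{\phi}$ are vectors of $r$ functions with $$\boldsymbol{\psi}^{(s)}(x)=\sqrt d\sum_{k\in\mathbb{Z}}\left[Q^{(s)+}_k\boldsymbol{\phi}(dx-k)+Q^{(s)-}_k\boldsymbol{\phi}(k-dx)\right].$$ All recursion coefficients are real $r\times r$ matrices, and only finitely many of them are nonzero. Inner product: $\langle \boldsymbol{f},\boldsymbol{g}\rangle=\int \boldsymbol{f}(x)\boldsymbol{g}(x)^*\,dx$, an $r\times r$ matrix; $*$ is the complex conjugate transpose. $\boldsymbol{\phi}$ is orthogonal if $\langle\boldsymbol{\phi}(x-j),\boldsymbol{\phi}(x-k)\rangle=\delta_{jk}I_r$ and $\langle\boldsymbol{\phi}(x-j),\boldsymbol{\phi}(k-x)\rangle=0$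 for all $j,k\in\mathbb{Z}$. Condition E: a matrix satisfies Condition E if it has a simple eigenvalue $1$ and all other eigenvalues are smaller than $1$ in absolute value. $\boldsymbol{\phi}$ satisfies Condition E if the $2r\times2r$ matrix $\frac1{\sqrt d}\sum_{k}\begin{bmatrix}P^+_k&P^-_k\\P^-_k&P^+_k\end{bmatrix}$ does. Approximation order: $\boldsymbol{\phi}$ provides approximation order $p$ if $\|f-P_nf\|=O(d^{-np})$ whenever $f$ has $p$ continuous derivatives, where $P_nf$ is the level-$n$ expansion $\sum_k[\langle f,\boldsymbol{\phi}^+_{nk}\rangle\boldsymbol{\phi}^+_{nk}+\langle f,\boldsymbol{\phi}^-_{nk}\rangle\boldsymbol{\phi}^-_{nk}]$ with $\boldsymbol{\phi}^{\pm}_{nk}(x)=d^{n/2}\boldsymbol{\phi}(\pm(d^nx-k))$. It is known to be equivalent to accuracy $p$: every polynomial of degree at most $p-1$ is locally a linear combination of the functions $\boldsymbol{\phi}(x-k)$ and $\boldsymbol{\phi}(k-x)$, $k\in\mathbb{Z}$. Discrete moments ($j=0,1,2,\dots$, with $k^0=1$ for all $k$), all $r\times r$ matrices: $$M^{+}_j=\frac1{\sqrt d}\sum_kk^jP^+_k,\quad M^-_j=\frac1{\sqrt d}\sum_kk^jP^-_k,\quad M_j=M^+_j+M^-_j,$$ $$N^{(s)+}_j=\frac1{\sqrt d}\sum_kk^jQ^{(s)+}_k,\quad N^{(s)-}_j=\frac1{\sqrt d}\sum_kk^jQ^{(s)-}_k.$$ Continuous moments: $\boldsymbol{m}_j=\int_{-\infty}^\infty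 x^j\boldsymbol{\phi}(x)\,dx$ and $\boldsymbol{n}^{(s)}_j=\int_{-\infty}^\infty x^j\boldsymbol{\psi}^{(s)}(x)\,dx$, vectors of size $r$. *)

theory Defs
  imports "HOL-Analysis.Analysis" "HOL-Computational_Algebra.Polynomial"
begin

text \<open>
  Functions \<open>real \<Rightarrow> complex ^ 'r\<close> play the role of the vectors of \<open>r\<close> real- or complex-valued
  functions, with \<open>r = CARD('r)\<close>.  Recursion coefficients are families \<open>int \<Rightarrow> real ^ 'r ^ 'r\<close>;
  since they are required to have finite support, the sums over all integers below,
  written with \<open>infsum\<close>, are finite sums.
\<close>

definition cmat :: "real ^ 'n ^ 'm \<Rightarrow> complex ^ 'n ^ 'm" where
  "cmat A = (\<chi> i j. complex_of_real (A $ i $ j))"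


subsection \<open>Square integrable functions\<close>

definition square_integrable :: "(real \<Rightarrow> complex) \<Rightarrow> bool" where
  "square_integrable f \<longleftrightarrow>
     f \<in> borel_measurable lborel \<and> integrable lborel (\<lambda>x. (cmod (f x))\<^sup>2)"

definition L2_norm :: "(real \<Rightarrow> complex) \<Rightarrow> real" where
  "L2_norm f = sqrt (LINT x|lborel. (cmod (f x))\<^sup>2)"

definition L2_closure :: "(real \<Rightarrow> complex) set \<Rightarrow> (real \<Rightarrow> complex) set" where
  "L2_closure S = {f. square_integrable f \<and>
     (\<forall>e>0. \<exists>g\<in>S. square_integrable g \<and> L2_norm (\<lambda>x. f x - g x) < e)}"

definition fun_span :: "(real \<Rightarrow> complex) set \<Rightarrow> (real \<Rightarrow> complex) set" where
  "fun_span G = {f. \<exists>T c. finite T \<and> T \<subseteq> G \<and> f = (\<lambda>x. \<Sum>g\<in>T. c g * g x)}"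

definition L2_inner_mat ::
    "(real \<Rightarrow> complex ^ 'r) \<Rightarrow> (real \<Rightarrow> complex ^ 'r) \<Rightarrow> complex ^ 'r ^ 'r" where
  "L2_inner_mat f g = (\<chi> a b. LINT x|lborel. f x $ a * cnj (g x $ b))"


subsection \<open>Two-direction multiscaling functions and multiwavelets\<close>

definition level_space :: "nat \<Rightarrow> (real \<Rightarrow> complex ^ 'r) \<Rightarrow> int \<Rightarrow> (real \<Rightarrow> complex) set" where
  "level_space d \<phi> j = L2_closure (fun_span
     ({\<lambda>x. \<phi> (real d powi j * x - of_int k) $ i | i k. True} \<union>
      {\<lambda>x. \<phi> (of_int k - real d powi j * x) $ i | i k. True}))"

definition stable_shifts :: "(real \<Rightarrow> complex ^ 'r) \<Rightarrow> bool" where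
  "stable_shifts \<phi> \<longleftrightarrow>
     (\<exists>A B. 0 < A \<and> 0 < B \<and>
       (\<forall>K a b. finite K \<longrightarrow>
         (let c2 = (\<Sum>k\<in>K. (norm (a k :: complex ^ 'r))\<^sup>2 + (norm (b k :: complex ^ 'r))\<^sup>2);
              f = (\<lambda>x. \<Sum>k\<in>K. \<Sum>i\<in>UNIV. a k $ i * \<phi> (x - of_int k) $ i
                                       + b k $ i * \<phi> (of_int k - x) $ i)
          in A * c2 \<le> (L2_norm f)\<^sup>2 \<and> (L2_norm f)\<^sup>2 \<le> B * c2)))"

text \<open>
  The usual axioms of a multiresolution approximation: nested spaces with trivial intersection
  and dense union, invariance under dilation and under translation, and a Riesz basis of the
  space of level 0 consisting of the components of \<open>\<phi>(x - k)\<close> and \<open>\<phi>(k - x)\<close>.  Elements of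
  \<open>L\<^sup>2\<close> are represented by functions, so the zero space is the set of all functions that vanish
  almost everywhere.
\<close>

definition generates_MRA :: "nat \<Rightarrow> (real \<Rightarrow> complex ^ 'r) \<Rightarrow> bool" where
  "generates_MRA d \<phi> \<longleftrightarrow>
     (\<forall>i. square_integrable (\<lambda>x. \<phi> x $ i)) \<and>
     (\<forall>j. level_space d \<phi> j \<subseteq> level_space d \<phi> (j + 1)) \<and>
     (\<Inter>j. level_space d \<phi> j) = {f. square_integrable f \<and> (AE x in lborel. f x = 0)} \<and>
     L2_closure (\<Union>j. level_space d \<phi> j) = {f. square_integrable f} \<and>
     (\<forall>j f. f \<in> level_space d \<phi> j \<longleftrightarrow> (\<lambda>x. f (real d * x)) \<in> level_space d \<phi> (j + 1)) \<and>
     (\<forall>j k f. f \<in> level_space d \<phi> j \<longleftrightarrow>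
        (\<lambda>x. f (x - real d powi (- j) * of_int k)) \<in> level_space d \<phi> j) \<and>
     stable_shifts \<phi>"

definition two_dir_comb ::
    "nat \<Rightarrow> (int \<Rightarrow> real ^ 'r ^ 'r) \<Rightarrow> (int \<Rightarrow> real ^ 'r ^ 'r) \<Rightarrow>
     (real \<Rightarrow> complex ^ 'r) \<Rightarrow> real \<Rightarrow> complex ^ 'r" where
  "two_dir_comb d Cp Cm \<phi> x = sqrt (real d) *\<^sub>R
     (\<Sum>\<^sub>\<infinity>k. cmat (Cp k) *v \<phi> (real d * x - of_int k) + cmat (Cm k) *v \<phi> (of_int k - real d * x))"

definition finitely_supported :: "(int \<Rightarrow> real ^ 'r ^ 'r) \<Rightarrow> bool" where
  "finitely_supported C \<longleftrightarrow> finite {k. C k \<noteq> 0}"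

definition two_dir_multiscaling ::
    "nat \<Rightarrow> (int \<Rightarrow> real ^ 'r ^ 'r) \<Rightarrow> (int \<Rightarrow> real ^ 'r ^ 'r) \<Rightarrow>
     (real \<Rightarrow> complex ^ 'r) \<Rightarrow> bool" where
  "two_dir_multiscaling d Pp Pm \<phi> \<longleftrightarrow>
     finitely_supported Pp \<and> finitely_supported Pm \<and>
     (\<forall>x. \<phi> x = two_dir_comb d Pp Pm \<phi> x) \<and>
     generates_MRA d \<phi>"

definition two_dir_multiwavelets ::
    "nat \<Rightarrow> (real \<Rightarrow> complex ^ 'r) \<Rightarrow> (nat \<Rightarrow> int \<Rightarrow> real ^ 'r ^ 'r) \<Rightarrow>
     (nat \<Rightarrow> int \<Rightarrow> real ^ 'r ^ 'r) \<Rightarrow> (nat \<Rightarrow> real \<Rightarrow> complex ^ 'r) \<Rightarrow> bool" where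
  "two_dir_multiwavelets d \<phi> Qp Qm \<psi> \<longleftrightarrow>
     (\<forall>s\<in>{1..d - 1}.
        finitely_supported (Qp s) \<and> finitely_supported (Qm s) \<and>
        (\<forall>x. \<psi> s x = two_dir_comb d (Qp s) (Qm s) \<phi> x))"

definition two_dir_orthogonal :: "(real \<Rightarrow> complex ^ 'r) \<Rightarrow> bool" where
  "two_dir_orthogonal \<phi> \<longleftrightarrow>
     (\<forall>j k :: int.
        L2_inner_mat (\<lambda>x. \<phi> (x - of_int j)) (\<lambda>x. \<phi> (x - of_int k)) = (if j = k then mat 1 else 0) \<and>
        L2_inner_mat (\<lambda>x. \<phi> (x - of_int j)) (\<lambda>x. \<phi> (of_int k - x)) = 0)"

definition compact_support :: "(real \<Rightarrow> complex ^ 'r) \<Rightarrow> bool" where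
  "compact_support f \<longleftrightarrow> compact (closure {x. f x \<noteq> 0})"


subsection \<open>Moments\<close>

definition discrete_moment :: "nat \<Rightarrow> (int \<Rightarrow> real ^ 'r ^ 'r) \<Rightarrow> nat \<Rightarrow> real ^ 'r ^ 'r" where
  "discrete_moment d C j = (1 / sqrt (real d)) *\<^sub>R (\<Sum>\<^sub>\<infinity>k. (of_int k ^ j) *\<^sub>R C k)"

definition cont_moment :: "(real \<Rightarrow> complex ^ 'r) \<Rightarrow> nat \<Rightarrow> complex ^ 'r" where
  "cont_moment f j = (LINT x|lborel. (x ^ j) *\<^sub>R f x)"


subsection \<open>Condition E\<close>

definition char_polynomial :: "complex ^ 'n ^ 'n \<Rightarrow> complex poly" where
  "char_polynomial A = det (mat [:0, 1:] - (\<chi> i j. [:A $ i $ j:]))"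

definition is_eigenvalue :: "complex ^ 'n ^ 'n \<Rightarrow> complex \<Rightarrow> bool" where
  "is_eigenvalue A z \<longleftrightarrow> (\<exists>v. v \<noteq> 0 \<and> A *v v = z *s v)"

text \<open>An eigenvalue is simple if its algebraic multiplicity is 1.\<close>

definition simple_eigenvalue :: "complex ^ 'n ^ 'n \<Rightarrow> complex \<Rightarrow> bool" where
  "simple_eigenvalue A z \<longleftrightarrow> is_eigenvalue A z \<and> order z (char_polynomial A) = 1"

definition matrix_condition_E :: "complex ^ 'n ^ 'n \<Rightarrow> bool" where
  "matrix_condition_E A \<longleftrightarrow>
     simple_eigenvalue A 1 \<and> (\<forall>z. is_eigenvalue A z \<and> z \<noteq> 1 \<longrightarrow> cmod z < 1)"

definition block_matrix ::
    "real ^ 'r ^ 'r \<Rightarrow> real ^ 'r ^ 'r \<Rightarrow> real ^ 'r ^ 'r \<Rightarrow> real ^ 'r ^ 'r \<Rightarrow>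
     real ^ ('r + 'r) ^ ('r + 'r)" where
  "block_matrix A B C D = (\<chi> i j.
     case i of
       Inl a \<Rightarrow> (case j of Inl b \<Rightarrow> A $ a $ b | Inr b \<Rightarrow> B $ a $ b)
     | Inr a \<Rightarrow> (case j of Inl b \<Rightarrow> C $ a $ b | Inr b \<Rightarrow> D $ a $ b))"

definition condition_E ::
    "nat \<Rightarrow> (int \<Rightarrow> real ^ 'r ^ 'r) \<Rightarrow> (int \<Rightarrow> real ^ 'r ^ 'r) \<Rightarrow> bool" where
  "condition_E d Pp Pm \<longleftrightarrow> matrix_condition_E (cmat
     ((1 / sqrt (real d)) *\<^sub>R (\<Sum>\<^sub>\<infinity>k. block_matrix (Pp k) (Pm k) (Pm k) (Pp k))))"

end

theory Submission
  imports Defs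
begin

text \<open>
  The formulas for the moments all come from one computation.  A two-direction combination of
  \<open>\<phi>\<close> is a sum of dilated translates of \<open>\<phi>\<close> and of its reflection, so its moments follow by an
  affine substitution and the binomial theorem (\<open>moment_two_dir_comb\<close>).  Applied to a wavelet,
  this is the stated formula.  Applied to the refinement equation, it is a fixed point equation
  for \<open>m\<^sub>0\<close>, and for \<open>j \<ge> 1\<close> a linear system for \<open>m\<^sub>j\<close> with the matrix
  \<open>d\<^sup>j I - (M\<^sub>0\<^sup>+ + (- 1)\<^sup>j M\<^sub>0\<^sup>-)\<close>.  The eigenvalues of \<open>M\<^sub>0\<^sup>+ \<plusminus> M\<^sub>0\<^sup>-\<close> are eigenvalues of the block
  matrix of Condition E, with eigenvectors \<open>(v, \<plusminus> v)\<close>, and therefore at most \<open>1\<close> in modulus, whereas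
  \<open>d\<^sup>j > 1\<close>; so the system is uniquely solvable (\<open>condition_E_invertible\<close>).

  The normalization of \<open>m\<^sub>0\<close> expresses that the orthonormal translates are complete.  Expand the
  indicator of \<open>[0, 1]\<close> at level \<open>n\<close>; after a dilation this is the indicator of \<open>[0, L]\<close> with
  \<open>L = d\<^sup>n\<close>, expanded in the orthonormal family \<open>\<phi> (x - k)\<close>, \<open>\<phi> (k - x)\<close>.  Every translate
  supported inside the interval has the conjugate of a component of \<open>m\<^sub>0\<close> as its coefficient, every
  translate supported outside has coefficient \<open>0\<close>, and only a bounded number of translates meets
  the ends.  The sum of the squared coefficients is thus \<open>2 L \<bar>m\<^sub>0\<bar>\<^sup>2 + O(1)\<close>, where the factor \<open>2\<close>
  counts the two directions.  By Bessel's inequality it is at most \<open>L\<close>, the squared norm of the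
  indicator, and by the density of the level spaces it is at least \<open>(1 - \<epsilon>) L\<close> for suitable large
  \<open>n\<close>.  Hence \<open>2 \<bar>m\<^sub>0\<bar>\<^sup>2 = 1\<close> (\<open>moment_zero_normalization\<close>).
\<close>

section \<open>Real matrices acting on complex vectors\<close>

lemma cmat_0 [simp]: "cmat 0 = 0"
  by (simp add: cmat_def vec_eq_iff)

lemma cmat_add: "cmat (A + B) = cmat A + cmat B"
  by (simp add: cmat_def vec_eq_iff)

lemma cmat_diff: "cmat (A - B) = cmat A - cmat B"
  by (simp add: cmat_def vec_eq_iff)

lemma cmat_scaleR: "cmat (c *\<^sub>R A) = c *\<^sub>R cmat A"
  unfolding vec_eq_iff by (simp add: cmat_def) (simp add: scaleR_conv_of_real)

lemma cmat_sum: "cmat (\<Sum>k\<in>K. A k) = (\<Sum>k\<in>K. cmat (A k))"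
  by (induction K rule: infinite_finite_induct) (simp_all add: cmat_add)

lemma cmat_mult: "cmat (A ** B) = cmat A ** cmat B"
  by (simp add: cmat_def vec_eq_iff matrix_matrix_mult_def)

lemma cmat_mat: "cmat (mat c) = mat (complex_of_real c)"
  by (simp add: cmat_def vec_eq_iff mat_def)

lemma scaleR_matrix_vector: "(c *\<^sub>R A) *v v = c *\<^sub>R (A *v (v :: complex ^ 'n))" for A :: "complex ^ 'n ^ 'm"
  by (simp add: vec_eq_iff matrix_vector_mult_def scaleR_sum_right)

lemma matrix_vector_scaleR: "A *v (c *\<^sub>R v) = c *\<^sub>R (A *v (v :: complex ^ 'n))" for A :: "complex ^ 'n ^ 'm"
  by (simp add: vec_eq_iff matrix_vector_mult_def scaleR_sum_right)

lemma sum_matrix_vector: "(\<Sum>k\<in>K. A k) *v v = (\<Sum>k\<in>K. A k *v (v :: complex ^ 'n))" for A :: "'k \<Rightarrow> complex ^ 'n ^ 'm"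
  by (induction K rule: infinite_finite_induct) (simp_all add: matrix_vector_mult_add_rdistrib)

section \<open>Finitely supported families and compactly supported functions\<close>

lemma infsum_finite_support:
  assumes "finite K" "\<And>k. k \<notin> K \<Longrightarrow> f k = 0"
  shows "infsum f UNIV = sum f K"
proof -
  have "infsum f UNIV = infsum f K" by (rule infsum_cong_neutral) (use assms in auto)
  then show ?thesis using assms by simp
qed

lemma finitely_supported_common:
  assumes "finitely_supported A" "finitely_supported B"
  obtains K where "finite K" "\<And>k. k \<notin> K \<Longrightarrow> A k = 0" "\<And>k. k \<notin> K \<Longrightarrow> B k = 0"
  using assms by (intro that[of "{k. A k \<noteq> 0} \<union> {k. B k \<noteq> 0}"]) (auto simp: finitely_supported_def)

lemma discrete_moment_finite:
  assumes "finite K" "\<And>k. k \<notin> K \<Longrightarrow> C k = 0"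
  shows "discrete_moment d C j = (1 / sqrt (real d)) *\<^sub>R (\<Sum>k\<in>K. (of_int k ^ j) *\<^sub>R C k)"
  unfolding discrete_moment_def by (subst infsum_finite_support[OF assms(1)]) (use assms in auto)

lemma compact_support_bound:
  assumes "compact_support (f :: real \<Rightarrow> complex ^ 'r)"
  obtains R :: nat where "\<And>x. \<bar>x\<bar> > real R \<Longrightarrow> f x = 0"
proof -
  have "bounded (closure {x. f x \<noteq> 0})"
    using assms unfolding compact_support_def by (rule compact_imp_bounded)
  then have "bounded {x. f x \<noteq> 0}"
    by (rule bounded_subset) (rule closure_subset)
  then obtain b where b: "f x \<noteq> 0 \<Longrightarrow> \<bar>x\<bar> \<le> b" for x
    unfolding bounded_real by blast
  obtain R :: nat where R: "b \<le> real R" using real_arch_simple by blast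
  show ?thesis
  proof (rule that)
    show "f x = 0" if "\<bar>x\<bar> > real R" for x
      using b[of x] R that by (cases "f x = 0") simp_all
  qed
qed

lemma integrable_vanishing_outside:
  fixes f :: "real \<Rightarrow> 'a :: euclidean_space"
  assumes "continuous_on UNIV f" "\<And>x. \<bar>x\<bar> > R \<Longrightarrow> f x = 0"
  shows "integrable lborel f"
proof -
  have "integrable lborel (\<lambda>x. indicator {-R..R} x *\<^sub>R f x)"
    by (rule borel_integrable_compact) (auto intro: continuous_on_subset[OF assms(1)])
  moreover have "(\<lambda>x. indicator {-R..R} x *\<^sub>R f x) = f"
  proof
    show "indicator {-R..R} x *\<^sub>R f x = f x" for x
      using assms(2)[of x] by (cases "\<bar>x\<bar> \<le> R") (auto simp: indicator_def abs_le_iff)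
  qed
  ultimately show ?thesis by simp
qed

lemma moment_integrable:
  fixes f :: "real \<Rightarrow> complex ^ 'r"
  assumes "continuous_on UNIV f" "compact_support f"
  shows "integrable lborel (\<lambda>x. x ^ j *\<^sub>R f x)"
proof -
  obtain R :: nat where "\<And>x. \<bar>x\<bar> > real R \<Longrightarrow> f x = 0"
    using compact_support_bound[OF assms(2)] by blast
  then show ?thesis
    by (intro integrable_vanishing_outside[of _ "real R"]) (auto intro!: continuous_intros assms)
qed

section \<open>Moments of two-direction combinations\<close>

text \<open>
  Reflecting \<open>f\<close> turns \<open>x ^ j\<close> into \<open>(- x) ^ j\<close>.  Since \<open>\<phi> (k - d x)\<close> is the reflection of \<open>\<phi>\<close>
  evaluated at \<open>d x - k\<close>, this is where every sign \<open>(- 1) ^ l\<close> in the moment formulas comes from.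
\<close>

lemma cont_moment_reflect: "cont_moment (\<lambda>x. f (- x)) j = (-1) ^ j *\<^sub>R cont_moment f j"
proof -
  have "cont_moment f j = (LINT x|lborel. (0 + (-1) * x) ^ j *\<^sub>R f (0 + (-1) * x))"
    using lborel_integral_real_affine[of "-1" "\<lambda>x. x ^ j *\<^sub>R f x" 0]
    unfolding cont_moment_def by simp
  also have "\<dots> = (LINT x|lborel. (-1) ^ j *\<^sub>R (x ^ j *\<^sub>R f (- x)))"
    by (simp add: power_mult_distrib[symmetric])
  also have "\<dots> = (-1) ^ j *\<^sub>R cont_moment (\<lambda>x. f (- x)) j"
    unfolding cont_moment_def by (rule integral_scaleR_right)
  finally show ?thesis by (simp add: power_mult_distrib[symmetric])
qed

text \<open>
  Substituting \<open>x = (y + a) / d\<close> and expanding \<open>(y + a) ^ j\<close> by the binomial theorem.  The extra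
  factor \<open>1 / d\<close> in \<open>1 / d ^ Suc j\<close> is the Jacobian.
\<close>

lemma dilated_moment:
  fixes f :: "real \<Rightarrow> complex ^ 'r"
  assumes int: "\<And>l. integrable lborel (\<lambda>x. x ^ l *\<^sub>R f x)" and d: "d > 0"
  shows "integrable lborel (\<lambda>x. x ^ j *\<^sub>R f (d * x - a))" (is ?I)
    and "(LINT x|lborel. x ^ j *\<^sub>R f (d * x - a)) =
      (1 / d ^ Suc j) *\<^sub>R (\<Sum>l\<le>j. (real (j choose l) * a ^ (j - l)) *\<^sub>R cont_moment f l)" (is ?E)
proof -
  let ?g = "\<lambda>x. x ^ j *\<^sub>R f (d * x - a)"
  have expand: "?g (a / d + (1 / d) * y) =
      (1 / d ^ j) *\<^sub>R (\<Sum>l\<le>j. (real (j choose l) * a ^ (j - l)) *\<^sub>R (y ^ l *\<^sub>R f y))" for y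
  proof -
    have "d * (a / d + (1 / d) * y) - a = y" using d by (simp add: field_simps)
    moreover have "(a / d + (1 / d) * y) ^ j = (1 / d ^ j) * (y + a) ^ j"
      by (simp add: add_divide_distrib[symmetric] power_divide add.commute)
    moreover have "(y + a) ^ j *\<^sub>R f y =
        (\<Sum>l\<le>j. (real (j choose l) * a ^ (j - l)) *\<^sub>R (y ^ l *\<^sub>R f y))"
      unfolding binomial_ring scaleR_sum_left by (intro sum.cong refl) (simp add: mult_ac)
    ultimately show ?thesis by (simp only: scaleR_scaleR[symmetric])
  qed
  have "integrable lborel (\<lambda>y. ?g (a / d + (1 / d) * y))"
    unfolding expand by (intro integrable_scaleR_right Bochner_Integration.integrable_sum int)
  moreover have "1 / d \<noteq> 0" using d by simp
  ultimately show ?I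
    using lborel_integrable_real_affine_iff[of "1 / d" ?g "a / d"] by blast
  have "(LINT x|lborel. ?g x) = (1 / d) *\<^sub>R (LINT y|lborel. ?g (a / d + (1 / d) * y))"
    using lborel_integral_real_affine[OF \<open>1 / d \<noteq> 0\<close>, of ?g "a / d"] d
    by (simp only: abs_of_pos zero_less_divide_1_iff)
  also have "(LINT y|lborel. ?g (a / d + (1 / d) * y)) =
     (1 / d ^ j) *\<^sub>R (LINT y|lborel. (\<Sum>l\<le>j. (real (j choose l) * a ^ (j - l)) *\<^sub>R (y ^ l *\<^sub>R f y)))"
    unfolding expand by (rule integral_scaleR_right)
  also have "(LINT y|lborel. (\<Sum>l\<le>j. (real (j choose l) * a ^ (j - l)) *\<^sub>R (y ^ l *\<^sub>R f y))) =
     (\<Sum>l\<le>j. LINT y|lborel. (real (j choose l) * a ^ (j - l)) *\<^sub>R (y ^ l *\<^sub>R f y))"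
    by (intro Bochner_Integration.integral_sum integrable_scaleR_right int)
  also have "\<dots> = (\<Sum>l\<le>j. (real (j choose l) * a ^ (j - l)) *\<^sub>R cont_moment f l)"
    unfolding cont_moment_def by (intro sum.cong refl integral_scaleR_right)
  finally show ?E by (simp only: scaleR_scaleR) simp
qed

text \<open>
  Every summand is a dilated translate of \<open>\<phi>\<close> or of its reflection, so \<open>dilated_moment\<close> applies
  to each of them.  The coefficients \<open>k ^ (j - l)\<close> that it produces, collected for a fixed \<open>l\<close>, add
  up to the discrete moments of order \<open>j - l\<close>.
\<close>

lemma moment_two_dir_comb:
  fixes \<phi> :: "real \<Rightarrow> complex ^ 'r"
  assumes cont: "continuous_on UNIV \<phi>" and supp: "compact_support \<phi>" and d: "d > 0"
    and fin: "finitely_supported Cp" "finitely_supported Cm"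
  shows "cont_moment (two_dir_comb d Cp Cm \<phi>) j =
    (1 / real d ^ j) *\<^sub>R (\<Sum>l\<le>j. real (j choose l) *\<^sub>R
       (cmat (discrete_moment d Cp (j - l) + (-1) ^ l *\<^sub>R discrete_moment d Cm (j - l))
          *v cont_moment \<phi> l))"
proof -
  obtain K where K: "finite K" "\<And>k. k \<notin> K \<Longrightarrow> Cp k = 0" "\<And>k. k \<notin> K \<Longrightarrow> Cm k = 0"
    using finitely_supported_common[OF fin] by blast
  let ?\<rho> = "\<lambda>x. \<phi> (- x)" and ?m = "cont_moment \<phi>"
  let ?b = "\<lambda>l k. real (j choose l) * of_int k ^ (j - l)"
  note int = moment_integrable[OF cont supp]
  have int': "integrable lborel (\<lambda>x. x ^ l *\<^sub>R ?\<rho> x)" for l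
  proof -
    have "integrable lborel (\<lambda>x. (0 + (-1) * x) ^ l *\<^sub>R \<phi> (0 + (-1) * x))"
      by (rule lborel_integrable_real_affine[OF int]) simp
    then have "integrable lborel (\<lambda>x. (-1) ^ l *\<^sub>R ((0 + (-1) * x) ^ l *\<^sub>R \<phi> (0 + (-1) * x)))"
      by (rule integrable_scaleR_right)
    then show ?thesis by (simp add: power_mult_distrib[symmetric])
  qed
  have d': "0 < real d" using d by simp
  have reflected: "\<phi> (of_int k - real d * x) = ?\<rho> (real d * x - of_int k)" for k x
    by simp
  have comb: "x ^ j *\<^sub>R two_dir_comb d Cp Cm \<phi> x = sqrt (real d) *\<^sub>R
     (\<Sum>k\<in>K. cmat (Cp k) *v (x ^ j *\<^sub>R \<phi> (real d * x - of_int k)) +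
        cmat (Cm k) *v (x ^ j *\<^sub>R ?\<rho> (real d * x - of_int k)))" for x
  proof -
    have "two_dir_comb d Cp Cm \<phi> x = sqrt (real d) *\<^sub>R
       (\<Sum>k\<in>K. cmat (Cp k) *v \<phi> (real d * x - of_int k) + cmat (Cm k) *v ?\<rho> (real d * x - of_int k))"
      unfolding two_dir_comb_def reflected
      by (intro arg_cong[where f = "scaleR (sqrt (real d))"] infsum_finite_support[OF K(1)])
        (simp add: K(2,3))
    then show ?thesis
      by (simp only: matrix_vector_scaleR scaleR_add_right[symmetric] scaleR_sum_right[symmetric]
          scaleR_left_commute)
  qed
  note I = dilated_moment(1)[OF int d'] dilated_moment(1)[OF int' d']
  note bl = matrix_vector_mul_bounded_linear
  define c where "c k l = real (j choose l) * of_int k ^ (j - l)" for k :: int and l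
  define v where "v k l = cmat (Cp k) *v ?m l + (-1) ^ l *\<^sub>R (cmat (Cm k) *v ?m l)" for k l
  have moment_matrix: "cmat (discrete_moment d Cp i + (-1) ^ l *\<^sub>R discrete_moment d Cm i) *v ?m l =
      (1 / sqrt (real d)) *\<^sub>R (\<Sum>k\<in>K. of_int k ^ i *\<^sub>R v k l)" for i l
  proof -
    have single: "cmat (discrete_moment d C i) *v ?m l =
        (1 / sqrt (real d)) *\<^sub>R (\<Sum>k\<in>K. of_int k ^ i *\<^sub>R (cmat (C k) *v ?m l))"
      if "\<forall>k. k \<notin> K \<longrightarrow> C k = 0" for C :: "int \<Rightarrow> real ^ 'r ^ 'r"
    proof -
      have "discrete_moment d C i = (1 / sqrt (real d)) *\<^sub>R (\<Sum>k\<in>K. of_int k ^ i *\<^sub>R C k)"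
        by (rule discrete_moment_finite[OF K(1)]) (simp add: that)
      then show ?thesis
        by (simp only: cmat_scaleR cmat_sum scaleR_matrix_vector sum_matrix_vector)
    qed
    have "cmat (discrete_moment d Cp i) *v ?m l =
        (1 / sqrt (real d)) *\<^sub>R (\<Sum>k\<in>K. of_int k ^ i *\<^sub>R (cmat (Cp k) *v ?m l))"
      "cmat (discrete_moment d Cm i) *v ?m l =
        (1 / sqrt (real d)) *\<^sub>R (\<Sum>k\<in>K. of_int k ^ i *\<^sub>R (cmat (Cm k) *v ?m l))"
      by (rule single; simp add: K)+
    then show ?thesis
      by (simp add: cmat_add cmat_scaleR matrix_vector_mult_add_rdistrib scaleR_matrix_vector
          v_def scaleR_add_right sum.distrib scaleR_sum_right mult.commute)
  qed
  have moment_shift: "(LINT x|lborel. x ^ j *\<^sub>R \<phi> (real d * x - of_int k)) =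
      (1 / real d ^ Suc j) *\<^sub>R (\<Sum>l\<le>j. c k l *\<^sub>R ?m l)"
    "(LINT x|lborel. x ^ j *\<^sub>R ?\<rho> (real d * x - of_int k)) =
      (1 / real d ^ Suc j) *\<^sub>R (\<Sum>l\<le>j. c k l *\<^sub>R ((-1) ^ l *\<^sub>R ?m l))" for k
    unfolding dilated_moment(2)[OF int d'] dilated_moment(2)[OF int' d'] cont_moment_reflect c_def
    by (rule refl)+
  have "cont_moment (two_dir_comb d Cp Cm \<phi>) j = sqrt (real d) *\<^sub>R
     (\<Sum>k\<in>K. cmat (Cp k) *v (LINT x|lborel. x ^ j *\<^sub>R \<phi> (real d * x - of_int k)) +
        cmat (Cm k) *v (LINT x|lborel. x ^ j *\<^sub>R ?\<rho> (real d * x - of_int k)))"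
  proof -
    let ?F = "\<lambda>k x. cmat (Cp k) *v (x ^ j *\<^sub>R \<phi> (real d * x - of_int k))"
    let ?G = "\<lambda>k x. cmat (Cm k) *v (x ^ j *\<^sub>R ?\<rho> (real d * x - of_int k))"
    have F: "integrable lborel (?F k)" "integrable lborel (?G k)" for k
      by (rule integrable_bounded_linear[OF bl], rule I)+
    have "(LINT x|lborel. (\<Sum>k\<in>K. ?F k x + ?G k x)) = (\<Sum>k\<in>K. LINT x|lborel. ?F k x + ?G k x)"
      by (rule Bochner_Integration.integral_sum) (rule Bochner_Integration.integrable_add[OF F])
    also have "\<dots> = (\<Sum>k\<in>K. (LINT x|lborel. ?F k x) + (LINT x|lborel. ?G k x))"
      by (intro sum.cong refl Bochner_Integration.integral_add F)
    finally show ?thesis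
      unfolding cont_moment_def comb integral_scaleR_right
        integral_bounded_linear[OF bl I(1)] integral_bounded_linear[OF bl I(2)] by (simp only:)
  qed
  also have "\<dots> = sqrt (real d) *\<^sub>R (\<Sum>k\<in>K. (1 / real d ^ Suc j) *\<^sub>R (\<Sum>l\<le>j. c k l *\<^sub>R v k l))"
    unfolding moment_shift matrix_vector_scaleR linear_sum[OF bounded_linear.linear[OF bl]] v_def
    by (simp only: scaleR_add_right sum.distrib)
  also have "\<dots> = (sqrt (real d) / real d ^ Suc j) *\<^sub>R (\<Sum>l\<le>j. \<Sum>k\<in>K. c k l *\<^sub>R v k l)"
    unfolding sum.swap[of _ K "{..j}"]
    by (simp only: scaleR_sum_right[symmetric] scaleR_scaleR times_divide_eq_right mult_1_right)
  also have "(\<Sum>l\<le>j. \<Sum>k\<in>K. c k l *\<^sub>R v k l) =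
      (\<Sum>l\<le>j. real (j choose l) *\<^sub>R (\<Sum>k\<in>K. of_int k ^ (j - l) *\<^sub>R v k l))"
    by (simp only: c_def scaleR_sum_right scaleR_scaleR)
  \<comment> \<open>One of the two factors \<open>1 / sqrt d\<close> contained in the Jacobian cancels the prefactor of the
    combination; the other is the normalization of the discrete moments.\<close>
  also have "sqrt (real d) / real d ^ Suc j = (1 / real d ^ j) * (1 / sqrt (real d))"
    using d' by (simp add: field_simps)
  finally show ?thesis
    unfolding moment_matrix by (simp only: scaleR_sum_right scaleR_scaleR mult_ac)
qed

section \<open>Condition E and invertibility\<close>

lemma block_matrix_discrete_moments:
  assumes "finitely_supported Pp" "finitely_supported Pm"
  shows "(1 / sqrt (real d)) *\<^sub>R (\<Sum>\<^sub>\<infinity>k. block_matrix (Pp k) (Pm k) (Pm k) (Pp k)) =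
    block_matrix (discrete_moment d Pp 0) (discrete_moment d Pm 0)
      (discrete_moment d Pm 0) (discrete_moment d Pp 0)"
proof -
  obtain K where K: "finite K" "\<And>k. k \<notin> K \<Longrightarrow> Pp k = 0" "\<And>k. k \<notin> K \<Longrightarrow> Pm k = 0"
    using finitely_supported_common[OF assms] by blast
  have "(\<Sum>\<^sub>\<infinity>k. block_matrix (Pp k) (Pm k) (Pm k) (Pp k)) =
      (\<Sum>k\<in>K. block_matrix (Pp k) (Pm k) (Pm k) (Pp k))"
    by (rule infsum_finite_support[OF K(1)])
       (simp add: K vec_eq_iff block_matrix_def split: sum.split)
  moreover have "discrete_moment d Pp 0 = (1 / sqrt (real d)) *\<^sub>R (\<Sum>k\<in>K. Pp k)"
    "discrete_moment d Pm 0 = (1 / sqrt (real d)) *\<^sub>R (\<Sum>k\<in>K. Pm k)"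
    using discrete_moment_finite[OF K(1), of Pp d 0] discrete_moment_finite[OF K(1), of Pm d 0] K(2,3)
    by simp_all
  ultimately show ?thesis
    by (simp add: vec_eq_iff block_matrix_def split: sum.split)
qed

text \<open>
  The block matrix with blocks \<open>A, B, B, A\<close> commutes with the exchange of the two halves of a
  vector.  Hence, with \<open>\<sigma>\<close> equal to \<open>1\<close> or \<open>- 1\<close>, an eigenvector \<open>v\<close> of \<open>A + \<sigma> B\<close> yields the
  eigenvector \<open>(v, \<sigma> v)\<close> of the block matrix for the same eigenvalue.
\<close>

lemma block_matrix_eigenvalue:
  fixes A B :: "real ^ 'r ^ 'r"
  assumes v: "v \<noteq> 0" "(A + \<sigma> *\<^sub>R B) *v v = z *\<^sub>R v" and \<sigma>: "\<sigma> * \<sigma> = 1"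
  shows "is_eigenvalue (cmat (block_matrix A B B A)) (complex_of_real z)"
proof -
  define w :: "complex ^ ('r + 'r)" where
    "w = (\<chi> i. case i of Inl a \<Rightarrow> complex_of_real (v $ a) | Inr a \<Rightarrow> complex_of_real (\<sigma> * v $ a))"
  have eig: "(\<Sum>b\<in>UNIV. A $ a $ b * v $ b) + (\<Sum>b\<in>UNIV. B $ a $ b * (\<sigma> * v $ b)) = z * v $ a" for a
  proof -
    have "((A + \<sigma> *\<^sub>R B) *v v) $ a = z * v $ a"
      by (simp add: v(2))
    then show ?thesis
      by (simp add: matrix_vector_mult_def sum.distrib algebra_simps)
  qed
  have eig': "(\<Sum>b\<in>UNIV. B $ a $ b * v $ b) + (\<Sum>b\<in>UNIV. A $ a $ b * (\<sigma> * v $ b)) = z * (\<sigma> * v $ a)" for a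
  proof -
    have "z * (\<sigma> * v $ a) = \<sigma> * ((\<Sum>b\<in>UNIV. A $ a $ b * v $ b) + (\<Sum>b\<in>UNIV. B $ a $ b * (\<sigma> * v $ b)))"
      unfolding eig by (simp only: mult_ac)
    also have "\<dots> = (\<Sum>b\<in>UNIV. A $ a $ b * (\<sigma> * v $ b)) + (\<Sum>b\<in>UNIV. B $ a $ b * (\<sigma> * \<sigma> * v $ b))"
      by (simp add: distrib_left sum_distrib_left mult_ac)
    finally show ?thesis using \<sigma> by simp
  qed
  have split_sum: "(\<Sum>i\<in>UNIV. f i) = (\<Sum>a\<in>UNIV. f (Inl a)) + (\<Sum>a\<in>UNIV. f (Inr a))"
    for f :: "'r + 'r \<Rightarrow> complex"
    using sum.Plus[of UNIV UNIV f] by simp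
  have row: "(cmat (block_matrix A B B A) *v w) $ i = (complex_of_real z *s w) $ i" for i
  proof (cases i)
    case (Inl a)
    have "(cmat (block_matrix A B B A) *v w) $ i =
        complex_of_real ((\<Sum>b\<in>UNIV. A $ a $ b * v $ b) + (\<Sum>b\<in>UNIV. B $ a $ b * (\<sigma> * v $ b)))"
      by (simp add: matrix_vector_mult_def split_sum cmat_def block_matrix_def w_def Inl)
    then show ?thesis by (simp only: eig) (simp add: w_def Inl)
  next
    case (Inr a)
    have "(cmat (block_matrix A B B A) *v w) $ i =
        complex_of_real ((\<Sum>b\<in>UNIV. B $ a $ b * v $ b) + (\<Sum>b\<in>UNIV. A $ a $ b * (\<sigma> * v $ b)))"
      by (simp add: matrix_vector_mult_def split_sum cmat_def block_matrix_def w_def Inr)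
    then show ?thesis by (simp only: eig') (simp add: w_def Inr)
  qed
  obtain a where "v $ a \<noteq> 0" using v(1) by (auto simp: vec_eq_iff)
  then have "w $ Inl a \<noteq> 0" by (simp add: w_def)
  then have "w \<noteq> 0" by (metis zero_index)
  moreover have "cmat (block_matrix A B B A) *v w = complex_of_real z *s w"
    using row by (simp add: vec_eq_iff)
  ultimately show ?thesis unfolding is_eigenvalue_def by blast
qed

lemma mat_vector_mult: "mat c *v v = c *\<^sub>R v" for v :: "real ^ 'n"
  by (simp add: vec_eq_iff matrix_vector_mult_def mat_def if_distrib[of "\<lambda>x. x * _"] cong: if_cong)

text \<open>
  Otherwise \<open>z\<close> would be an eigenvalue of \<open>M\<^sub>0\<^sup>+ + \<sigma> M\<^sub>0\<^sup>-\<close>, hence of the block matrix of Condition E,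
  all of whose eigenvalues lie in the closed unit disc.
\<close>

lemma condition_E_invertible:
  fixes Pp Pm :: "int \<Rightarrow> real ^ 'r ^ 'r"
  assumes fin: "finitely_supported Pp" "finitely_supported Pm"
    and E: "condition_E d Pp Pm" and z: "z > 1" and \<sigma>: "\<sigma> * \<sigma> = 1"
  shows "invertible (mat z - (discrete_moment d Pp 0 + \<sigma> *\<^sub>R discrete_moment d Pm 0))"
proof -
  let ?A = "discrete_moment d Pp 0" and ?B = "discrete_moment d Pm 0"
  let ?T = "mat z - (?A + \<sigma> *\<^sub>R ?B)"
  have "v = 0" if v: "?T *v v = 0" for v
  proof (rule ccontr)
    assume "v \<noteq> 0"
    moreover have "(?A + \<sigma> *\<^sub>R ?B) *v v = z *\<^sub>R v"
      using v by (simp add: matrix_vector_mult_diff_rdistrib mat_vector_mult)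
    ultimately have "is_eigenvalue (cmat (block_matrix ?A ?B ?B ?A)) (complex_of_real z)"
      using \<sigma> by (rule block_matrix_eigenvalue)
    then have "cmod (complex_of_real z) < 1 \<or> complex_of_real z = 1"
      using E unfolding condition_E_def matrix_condition_E_def block_matrix_discrete_moments[OF fin]
      by blast
    then show False using z by auto
  qed
  then show ?thesis
    unfolding invertible_left_inverse matrix_left_invertible_ker by blast
qed

lemma matrix_inv_solve:
  fixes T :: "real ^ 'r ^ 'r" and v w :: "complex ^ 'r"
  assumes "invertible T" "cmat T *v v = w"
  shows "v = cmat (matrix_inv T) *v w"
proof -
  have left: "matrix_inv T ** T = mat 1"
    using someI_ex[OF assms(1)[unfolded invertible_def]] by (simp add: matrix_inv_def)
  have "cmat (matrix_inv T) *v (cmat T *v v) = cmat (matrix_inv T ** T) *v v"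
    by (simp add: cmat_mult matrix_vector_mul_assoc)
  also have "\<dots> = v"
    by (simp add: left cmat_mat)
  finally show ?thesis by (simp add: assms(2))
qed

section \<open>Square integrable functions and orthonormal families\<close>

definition L2_inner :: "(real \<Rightarrow> complex) \<Rightarrow> (real \<Rightarrow> complex) \<Rightarrow> complex" where
  "L2_inner f g = (LINT x|lborel. f x * cnj (g x))"

lemma integrable_mult_cnj:
  assumes "square_integrable f" "square_integrable g"
  shows "integrable lborel (\<lambda>x. f x * cnj (g x))"
proof (rule Bochner_Integration.integrable_bound)
  show "integrable lborel (\<lambda>x. (cmod (f x))\<^sup>2 + (cmod (g x))\<^sup>2)"
    using assms by (auto simp: square_integrable_def)
  have "(\<lambda>x. cnj (g x)) \<in> borel_measurable lborel"
    using assms(2) borel_measurable_continuous_onI[OF continuous_on_cnj[OF continuous_on_id]]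
    unfolding square_integrable_def by (blast intro: measurable_compose)
  then show "(\<lambda>x. f x * cnj (g x)) \<in> borel_measurable lborel"
    using assms(1) by (auto simp: square_integrable_def)
  have "a * b \<le> a\<^sup>2 + b\<^sup>2" if "0 \<le> a" "0 \<le> b" for a b :: real
    using sum_squares_bound[of a b] mult_nonneg_nonneg[OF that] by linarith
  then show "AE x in lborel. norm (f x * cnj (g x)) \<le> norm ((cmod (f x))\<^sup>2 + (cmod (g x))\<^sup>2)"
    by (simp add: norm_mult)
qed

lemma cmod_add_square_le: "(cmod (a + b))\<^sup>2 \<le> 2 * (cmod a)\<^sup>2 + 2 * (cmod b)\<^sup>2"
proof -
  have "(cmod (a + b))\<^sup>2 \<le> (cmod a + cmod b)\<^sup>2"
    by (intro power_mono norm_triangle_ineq norm_ge_zero)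
  also have "\<dots> \<le> 2 * (cmod a)\<^sup>2 + 2 * (cmod b)\<^sup>2"
    using sum_squares_bound[of "cmod a" "cmod b"] by (simp add: power2_sum)
  finally show ?thesis .
qed

lemma square_integrable_add:
  assumes "square_integrable f" "square_integrable g"
  shows "square_integrable (\<lambda>x. f x + g x)"
  unfolding square_integrable_def
proof
  show m: "(\<lambda>x. f x + g x) \<in> borel_measurable lborel"
    using assms by (auto simp: square_integrable_def)
  show "integrable lborel (\<lambda>x. (cmod (f x + g x))\<^sup>2)"
  proof (rule Bochner_Integration.integrable_bound)
    show "integrable lborel (\<lambda>x. 2 * (cmod (f x))\<^sup>2 + 2 * (cmod (g x))\<^sup>2)"
      using assms by (auto simp: square_integrable_def)
    show "(\<lambda>x. (cmod (f x + g x))\<^sup>2) \<in> borel_measurable lborel"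
      using m by measurable
    show "AE x in lborel. norm ((cmod (f x + g x))\<^sup>2) \<le> norm (2 * (cmod (f x))\<^sup>2 + 2 * (cmod (g x))\<^sup>2)"
      using cmod_add_square_le by simp
  qed
qed

lemma square_integrable_cmult:
  assumes "square_integrable f"
  shows "square_integrable (\<lambda>x. c * f x)"
  using assms by (auto simp: square_integrable_def norm_mult power_mult_distrib)

lemma square_integrable_diff:
  assumes "square_integrable f" "square_integrable g"
  shows "square_integrable (\<lambda>x. f x - g x)"
  using square_integrable_add[OF assms(1) square_integrable_cmult[OF assms(2), of "-1"]] by simp

lemma square_integrable_sum:
  assumes "\<And>p. p \<in> I \<Longrightarrow> square_integrable (e p)"
  shows "square_integrable (\<lambda>x. \<Sum>p\<in>I. e p x)"
  using assms
proof (induction I rule: infinite_finite_induct)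
  case (insert p I)
  then show ?case using square_integrable_add[of "e p" "\<lambda>x. \<Sum>p\<in>I. e p x"] by simp
qed (simp_all add: square_integrable_def)

lemma square_integrable_affine:
  assumes "square_integrable f" "c \<noteq> 0"
  shows "square_integrable (\<lambda>x. f (t + c * x))"
proof -
  have "integrable lborel (\<lambda>x. (cmod (f (t + c * x)))\<^sup>2)"
    using assms lborel_integrable_real_affine[of "\<lambda>x. (cmod (f x))\<^sup>2" c t]
    by (auto simp: square_integrable_def)
  moreover have "(\<lambda>x. f (t + c * x)) \<in> borel_measurable lborel"
    using assms(1) by (auto simp: square_integrable_def)
  ultimately show ?thesis by (simp add: square_integrable_def)
qed

lemma square_integrable_indicator: "square_integrable (indicator {a..b})"
proof -
  have "integrable lborel (indicator {a..b} :: real \<Rightarrow> real)"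
    by (rule integrable_real_indicator) (simp_all add: emeasure_lborel_Icc_eq)
  moreover have "(\<lambda>x. (cmod (indicator {a..b} x))\<^sup>2) = (indicator {a..b} :: real \<Rightarrow> real)"
    by (auto simp: indicator_def fun_eq_iff)
  ultimately show ?thesis by (simp add: square_integrable_def)
qed

lemma L2_inner_self: "L2_inner f f = complex_of_real (LINT x|lborel. (cmod (f x))\<^sup>2)"
  unfolding L2_inner_def complex_norm_square[symmetric] integral_complex_of_real ..

lemma L2_inner_cnj: "cnj (L2_inner f g) = L2_inner g f"
proof -
  have "L2_inner g f = (LINT x|lborel. cnj (f x * cnj (g x)))"
    by (simp add: L2_inner_def mult.commute)
  then show ?thesis by (simp only: Bochner_Integration.integral_cnj L2_inner_def)
qed

lemma L2_inner_diff_left: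
  assumes "square_integrable f" "square_integrable g" "square_integrable h"
  shows "L2_inner (\<lambda>x. f x - g x) h = L2_inner f h - L2_inner g h"
  unfolding L2_inner_def left_diff_distrib
  by (intro Bochner_Integration.integral_diff integrable_mult_cnj assms)

lemma L2_inner_sum_left:
  assumes "\<And>p. p \<in> I \<Longrightarrow> square_integrable (e p)" "square_integrable h"
  shows "L2_inner (\<lambda>x. \<Sum>p\<in>I. c p * e p x) h = (\<Sum>p\<in>I. c p * L2_inner (e p) h)"
proof -
  have "L2_inner (\<lambda>x. \<Sum>p\<in>I. c p * e p x) h = (LINT x|lborel. (\<Sum>p\<in>I. c p * (e p x * cnj (h x))))"
    unfolding L2_inner_def by (simp add: sum_distrib_right mult.assoc)
  also have "\<dots> = (\<Sum>p\<in>I. LINT x|lborel. c p * (e p x * cnj (h x)))"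
    by (intro Bochner_Integration.integral_sum integrable_mult_right integrable_mult_cnj assms)
  finally show ?thesis by (simp add: L2_inner_def)
qed

text \<open>
  The Pythagorean identity for an orthonormal family.  With \<open>c p\<close> the inner product of \<open>f\<close> and
  \<open>e p\<close> it gives Bessel's inequality; dropping the last sum, it bounds from below the distance
  from \<open>f\<close> to an arbitrary combination.
\<close>

lemma L2_distance_to_combination:
  assumes I: "finite I" and f: "square_integrable f"
    and e: "\<And>p. p \<in> I \<Longrightarrow> square_integrable (e p)"
    and orth: "\<And>p q. p \<in> I \<Longrightarrow> q \<in> I \<Longrightarrow> L2_inner (e p) (e q) = (if p = q then 1 else 0)"
  shows "(LINT x|lborel. (cmod (f x - (\<Sum>p\<in>I. c p * e p x)))\<^sup>2) =
    (LINT x|lborel. (cmod (f x))\<^sup>2) - (\<Sum>p\<in>I. (cmod (L2_inner f (e p)))\<^sup>2)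
      + (\<Sum>p\<in>I. (cmod (c p - L2_inner f (e p)))\<^sup>2)"
proof -
  define h where "h = (\<lambda>x. \<Sum>p\<in>I. c p * e p x)"
  define a where "a p = L2_inner f (e p)" for p
  have h: "square_integrable h"
    unfolding h_def by (intro square_integrable_sum square_integrable_cmult e)
  have fh: "square_integrable (\<lambda>x. f x - h x)" by (rule square_integrable_diff[OF f h])
  have he: "L2_inner h (e q) = c q" if "q \<in> I" for q
  proof -
    have "L2_inner h (e q) = (\<Sum>p\<in>I. c p * L2_inner (e p) (e q))"
      unfolding h_def by (rule L2_inner_sum_left[OF e e[OF that]])
    also have "\<dots> = (\<Sum>p\<in>I. if p = q then c p else 0)"
      by (intro sum.cong refl) (simp add: orth that)
    finally show ?thesis using I that by simp
  qed
  have hg: "L2_inner g h = (\<Sum>p\<in>I. cnj (c p) * L2_inner g (e p))" if "square_integrable g" for g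
  proof -
    have "L2_inner h g = (\<Sum>p\<in>I. c p * L2_inner (e p) g)"
      unfolding h_def by (rule L2_inner_sum_left[OF e that])
    then have "cnj (L2_inner h g) = (\<Sum>p\<in>I. cnj (c p) * cnj (L2_inner (e p) g))" by simp
    then show ?thesis by (simp only: L2_inner_cnj)
  qed
  have "L2_inner (\<lambda>x. f x - h x) (\<lambda>x. f x - h x) =
      L2_inner f (\<lambda>x. f x - h x) - L2_inner h (\<lambda>x. f x - h x)"
    by (rule L2_inner_diff_left[OF f h fh])
  also have "\<dots> = cnj (L2_inner f f - L2_inner h f) - cnj (L2_inner f h - L2_inner h h)"
    by (simp only: L2_inner_diff_left[OF f h f, symmetric] L2_inner_diff_left[OF f h h, symmetric] L2_inner_cnj)
  also have "\<dots> = L2_inner f f - L2_inner f h - cnj (L2_inner f h) + L2_inner h h"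
    by (simp add: L2_inner_cnj)
  also have "\<dots> = L2_inner f f + (\<Sum>p\<in>I. cnj (c p) * c p - cnj (c p) * a p - c p * cnj (a p))"
    unfolding hg[OF f] hg[OF h] a_def by (simp add: he sum.distrib sum_subtractf)
  also have "(\<Sum>p\<in>I. cnj (c p) * c p - cnj (c p) * a p - c p * cnj (a p)) =
      (\<Sum>p\<in>I. complex_of_real ((cmod (c p - a p))\<^sup>2 - (cmod (a p))\<^sup>2))"
    by (intro sum.cong refl) (simp add: complex_norm_square algebra_simps del: of_real_power)
  finally have "complex_of_real (LINT x|lborel. (cmod (f x - h x))\<^sup>2) =
      complex_of_real ((LINT x|lborel. (cmod (f x))\<^sup>2) + (\<Sum>p\<in>I. (cmod (c p - a p))\<^sup>2 - (cmod (a p))\<^sup>2))"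
    unfolding L2_inner_self by (simp only: of_real_add of_real_sum)
  then have "(LINT x|lborel. (cmod (f x - h x))\<^sup>2) =
      (LINT x|lborel. (cmod (f x))\<^sup>2) + (\<Sum>p\<in>I. (cmod (c p - a p))\<^sup>2 - (cmod (a p))\<^sup>2)"
    by (simp only: of_real_eq_iff)
  then show ?thesis unfolding h_def a_def by (simp add: sum_subtractf)
qed

text \<open>
  A crude form of Minkowski's inequality, from \<open>\<bar>a + b\<bar>\<^sup>2 \<le> 2 \<bar>a\<bar>\<^sup>2 + 2 \<bar>b\<bar>\<^sup>2\<close>.  The constant is
  immaterial, as \<open>\<epsilon>\<close> is arbitrary where this is applied.
\<close>

lemma L2_distance_triangle:
  assumes f: "square_integrable f" and g: "square_integrable g" and h: "square_integrable h"
    and 1: "L2_norm (\<lambda>x. f x - g x) < \<epsilon>" and 2: "L2_norm (\<lambda>x. g x - h x) < \<epsilon>"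
  shows "(LINT x|lborel. (cmod (f x - h x))\<^sup>2) \<le> 4 * \<epsilon>\<^sup>2"
proof -
  have sq: "square_integrable (\<lambda>x. f x - g x)" "square_integrable (\<lambda>x. g x - h x)"
    "square_integrable (\<lambda>x. f x - h x)"
    using f g h by (auto intro: square_integrable_diff)
  have small: "(LINT x|lborel. (cmod (u x))\<^sup>2) \<le> \<epsilon>\<^sup>2" if "L2_norm u < \<epsilon>" for u
  proof -
    have nn: "0 \<le> (LINT x|lborel. (cmod (u x))\<^sup>2)" by simp
    have "(L2_norm u)\<^sup>2 \<le> \<epsilon>\<^sup>2"
      using that nn by (intro power_mono) (auto simp: L2_norm_def)
    then show ?thesis using nn by (simp add: L2_norm_def)
  qed
  have "(LINT x|lborel. (cmod (f x - h x))\<^sup>2) \<le>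
      (LINT x|lborel. 2 * (cmod (f x - g x))\<^sup>2 + 2 * (cmod (g x - h x))\<^sup>2)"
  proof (rule integral_mono)
    show "(cmod (f x - h x))\<^sup>2 \<le> 2 * (cmod (f x - g x))\<^sup>2 + 2 * (cmod (g x - h x))\<^sup>2" for x
      using cmod_add_square_le[of "f x - g x" "g x - h x"] by simp
  qed (use sq in \<open>auto simp: square_integrable_def\<close>)
  also have "\<dots> = 2 * (LINT x|lborel. (cmod (f x - g x))\<^sup>2) + 2 * (LINT x|lborel. (cmod (g x - h x))\<^sup>2)"
    using sq by (subst Bochner_Integration.integral_add) (auto simp: square_integrable_def)
  finally show ?thesis using small[OF 1] small[OF 2] by simp
qed

section \<open>The translates of a two-direction scaling function\<close>

text \<open>
  One index set for all the components of \<open>\<phi> (x - k)\<close> (first entry \<open>True\<close>) and of \<open>\<phi> (k - x)\<close>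
  (first entry \<open>False\<close>), so that sums over both directions become sums over triples.
\<close>

definition two_dir_shift :: "(real \<Rightarrow> complex ^ 'r) \<Rightarrow> bool \<times> int \<times> 'r \<Rightarrow> real \<Rightarrow> complex" where
  "two_dir_shift \<phi> = (\<lambda>(s, k, i) x. (if s then \<phi> (x - of_int k) else \<phi> (of_int k - x)) $ i)"

lemma lborel_integral_reflect: "(LINT x|lborel. f (a - x)) = (LINT x|lborel. f x)"
  for f :: "real \<Rightarrow> 'a :: euclidean_space"
  using lborel_integral_real_affine[of "-1" f a] by simp

lemma lborel_integral_shift: "(LINT x|lborel. f (x - a)) = (LINT x|lborel. f x)"
  for f :: "real \<Rightarrow> 'a :: euclidean_space"
  using lborel_integral_real_affine[of 1 f "- a"] by simp

lemma two_dir_shift_integral: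
  fixes f :: "complex \<Rightarrow> 'a :: euclidean_space"
  shows "(LINT x|lborel. f (two_dir_shift \<phi> (s, k, i) x)) = (LINT x|lborel. f (\<phi> x $ i))"
  by (cases s) (simp_all add: two_dir_shift_def lborel_integral_reflect[of "\<lambda>x. f (\<phi> x $ i)"]
      lborel_integral_shift[of "\<lambda>x. f (\<phi> x $ i)"])

lemma two_dir_shift_square_integrable:
  assumes "\<And>i. square_integrable (\<lambda>x. \<phi> x $ i)"
  shows "square_integrable (two_dir_shift \<phi> p)"
proof (cases p)
  case (fields s k i)
  show ?thesis
    using square_integrable_affine[OF assms[of i], of 1 "- of_int k"]
      square_integrable_affine[OF assms[of i], of "-1" "of_int k"]
    by (cases s) (simp_all add: fields two_dir_shift_def)
qed

text \<open>
  Orthogonality is postulated for two forward translates and for a forward and a reversed one.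
  Two reversed translates are reduced to two forward ones by \<open>x \<mapsto> k + l - x\<close>.
\<close>

lemma two_dir_shift_orthonormal:
  assumes "two_dir_orthogonal \<phi>"
  shows "L2_inner (two_dir_shift \<phi> p) (two_dir_shift \<phi> q) = (if p = q then 1 else 0)"
proof -
  have same: "L2_inner (two_dir_shift \<phi> (True, k, i)) (two_dir_shift \<phi> (True, l, j)) =
      (if k = l \<and> i = j then 1 else 0)" for k l i j
  proof -
    have "L2_inner_mat (\<lambda>x. \<phi> (x - of_int k)) (\<lambda>x. \<phi> (x - of_int l)) = (if k = l then mat 1 else 0)"
      using assms unfolding two_dir_orthogonal_def by blast
    then have "L2_inner_mat (\<lambda>x. \<phi> (x - of_int k)) (\<lambda>x. \<phi> (x - of_int l)) $ i $ j =
        (if k = l then mat 1 else 0) $ i $ j" by (rule arg_cong)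
    then show ?thesis
      by (simp add: L2_inner_mat_def L2_inner_def two_dir_shift_def mat_def split: if_splits)
  qed
  have opposite: "L2_inner (two_dir_shift \<phi> (True, k, i)) (two_dir_shift \<phi> (False, l, j)) = 0" for k l i j
  proof -
    have "L2_inner_mat (\<lambda>x. \<phi> (x - of_int k)) (\<lambda>x. \<phi> (of_int l - x)) = 0"
      using assms unfolding two_dir_orthogonal_def by blast
    then have "L2_inner_mat (\<lambda>x. \<phi> (x - of_int k)) (\<lambda>x. \<phi> (of_int l - x)) $ i $ j = 0 $ i $ j"
      by (rule arg_cong)
    then show ?thesis
      by (simp add: L2_inner_mat_def L2_inner_def two_dir_shift_def)
  qed
  have reversed: "L2_inner (two_dir_shift \<phi> (False, k, i)) (two_dir_shift \<phi> (False, l, j)) =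
      L2_inner (two_dir_shift \<phi> (True, l, i)) (two_dir_shift \<phi> (True, k, j))" for k l i j
    using lborel_integral_reflect[of "\<lambda>x. \<phi> (x - of_int l) $ i * cnj (\<phi> (x - of_int k) $ j)"
        "of_int k + of_int l"]
    by (simp add: L2_inner_def two_dir_shift_def)
  obtain s k i where p: "p = (s, k, i)" by (cases p)
  obtain t l j where q: "q = (t, l, j)" by (cases q)
  have "L2_inner (two_dir_shift \<phi> (False, k, i)) (two_dir_shift \<phi> (True, l, j)) = 0"
    using opposite[of l j k i] L2_inner_cnj[of "two_dir_shift \<phi> (True, l, j)" "two_dir_shift \<phi> (False, k, i)"]
    by simp
  then show ?thesis
    unfolding p q by (cases s; cases t) (auto simp: same opposite reversed)
qed

lemma level_space_mono:
  assumes "generates_MRA d \<phi>"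
  shows "level_space d \<phi> j \<subseteq> level_space d \<phi> (j + int n)"
proof (induction n)
  case (Suc n)
  have "level_space d \<phi> (j + int n) \<subseteq> level_space d \<phi> (j + int n + 1)"
    using assms unfolding generates_MRA_def by blast
  then show ?case using Suc by (simp add: algebra_simps)
qed simp

text \<open>
  A span is described by finite sets of functions; choosing an index triple for each of its
  members rewrites such a combination as a sum over triples, to which orthonormality applies.
\<close>

lemma span_as_dilated_combination:
  assumes "h \<in> fun_span
     ({\<lambda>x. \<phi> (c * x - of_int k) $ i | i k. True} \<union> {\<lambda>x. \<phi> (of_int k - c * x) $ i | i k. True})"
  obtains I a where "finite I" "\<And>x. h x = (\<Sum>p\<in>I. a p * two_dir_shift \<phi> p (c * x))"
proof -
  let ?dil = "\<lambda>p x. two_dir_shift \<phi> p (c * x)"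
  obtain T b where T: "finite T" "h = (\<lambda>x. \<Sum>g\<in>T. b g * g x)"
    "T \<subseteq> {\<lambda>x. \<phi> (c * x - of_int k) $ i | i k. True} \<union> {\<lambda>x. \<phi> (of_int k - c * x) $ i | i k. True}"
    using assms unfolding fun_span_def by blast
  have "\<exists>p. g = ?dil p" if gT: "g \<in> T" for g
  proof -
    consider i k where "g = (\<lambda>x. \<phi> (c * x - of_int k) $ i)" | i k where "g = (\<lambda>x. \<phi> (of_int k - c * x) $ i)"
      using subsetD[OF T(3) gT] unfolding Un_iff mem_Collect_eq by blast
    then show ?thesis
    proof cases
      case (1 i k)
      then show ?thesis by (intro exI[of _ "(True, k, i)"]) (simp add: two_dir_shift_def)
    next
      case (2 i k)
      then show ?thesis by (intro exI[of _ "(False, k, i)"]) (simp add: two_dir_shift_def)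
    qed
  qed
  then obtain q where q: "\<And>g. g \<in> T \<Longrightarrow> ?dil (q g) = g" by metis
  then have inj: "inj_on q T" by (metis inj_onI)
  show ?thesis
  proof (rule that)
    show "finite (q ` T)" using T(1) by simp
    show "h x = (\<Sum>p\<in>q ` T. b (?dil p) * two_dir_shift \<phi> p (c * x))" for x
      unfolding sum.reindex[OF inj] T(2) by (intro sum.cong refl) (simp add: q fun_cong[OF q])
  qed
qed

text \<open>
  Density of the union of the level spaces, applied to the indicator of \<open>[0, 1]\<close> and dilated by
  \<open>d ^ n\<close>.  Dilation moves the level \<open>n\<close> to the level \<open>0\<close>, the interval to \<open>[0, d ^ n]\<close>, and
  multiplies squared norms by \<open>d ^ n\<close>.  The level can be taken as large as desired because
  the level spaces are nested.
\<close>

lemma indicator_approximation: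
  fixes \<phi> :: "real \<Rightarrow> complex ^ 'r"
  assumes mra: "generates_MRA d \<phi>" and d: "d \<ge> 2" and \<epsilon>: "\<epsilon> > 0"
  shows "\<exists>n\<ge>N. \<exists>I a. finite I \<and>
    (LINT x|lborel. (cmod (indicator {0..real d ^ n} x - (\<Sum>p\<in>I. a p * two_dir_shift \<phi> p x)))\<^sup>2)
      \<le> 4 * \<epsilon>\<^sup>2 * real d ^ n"
proof -
  let ?f = "indicator {0..1} :: real \<Rightarrow> complex"
  have sqf: "square_integrable ?f" by (rule square_integrable_indicator)
  have "?f \<in> L2_closure (\<Union>j. level_space d \<phi> j)"
    using mra sqf unfolding generates_MRA_def by blast
  then obtain g j where g: "g \<in> level_space d \<phi> j" "square_integrable g" "L2_norm (\<lambda>x. ?f x - g x) < \<epsilon>"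
    using \<epsilon> unfolding L2_closure_def by blast
  define n where "n = max N (nat j)"
  have "j \<le> int n" using max.cobounded2[of "nat j" N] unfolding n_def by linarith
  then have "int n = j + int (nat (int n - j))" by simp
  then have "g \<in> level_space d \<phi> (int n)"
    using g(1) level_space_mono[OF mra, of j "nat (int n - j)"] by auto
  then obtain h where h: "square_integrable h" "L2_norm (\<lambda>x. g x - h x) < \<epsilon>"
     "h \<in> fun_span ({\<lambda>x. \<phi> (real d ^ n * x - of_int k) $ i | i k. True} \<union>
        {\<lambda>x. \<phi> (of_int k - real d ^ n * x) $ i | i k. True})"
    using \<epsilon> unfolding level_space_def L2_closure_def power_int_of_nat by blast
  obtain I a where I: "finite I" "\<And>x. h x = (\<Sum>p\<in>I. a p * two_dir_shift \<phi> p (real d ^ n * x))"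
    using span_as_dilated_combination[OF h(3)] by blast
  define F where "F x = (cmod (indicator {0..real d ^ n} x - (\<Sum>p\<in>I. a p * two_dir_shift \<phi> p x)))\<^sup>2" for x
  have D: "real d ^ n > 0" using d by simp
  have "(LINT x|lborel. F x) = real d ^ n * (LINT x|lborel. F (0 + real d ^ n * x))"
    using lborel_integral_real_affine[of "real d ^ n" F 0] D by simp
  also have "(\<lambda>x. F (0 + real d ^ n * x)) = (\<lambda>x. (cmod (?f x - h x))\<^sup>2)"
  proof
    fix x
    have "(indicator {0..real d ^ n} (real d ^ n * x) :: complex) = indicator {0..1} x"
      using mult_le_cancel_left_pos[OF D, of 0 x] mult_le_cancel_left_pos[OF D, of x 1]
      by (simp add: indicator_def)
    then show "F (0 + real d ^ n * x) = (cmod (?f x - h x))\<^sup>2" by (simp add: F_def I(2))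
  qed
  also have "real d ^ n * (LINT x|lborel. (cmod (?f x - h x))\<^sup>2) \<le> real d ^ n * (4 * \<epsilon>\<^sup>2)"
    using L2_distance_triangle[OF sqf g(2) h(1) g(3) h(2)] D by (intro mult_left_mono) auto
  finally have "(LINT x|lborel. F x) \<le> 4 * \<epsilon>\<^sup>2 * real d ^ n" by (simp add: mult_ac)
  moreover have "n \<ge> N" by (simp add: n_def)
  ultimately show ?thesis using I(1) unfolding F_def by blast
qed

text \<open>
  The translates indexed by \<open>k\<close> live on \<open>[k - R, k + R]\<close>.  If this interval is contained in
  \<open>[0, L]\<close>, the inner product with the indicator of \<open>[0, L]\<close> is the full integral, which is the
  conjugate of a component of \<open>m\<^sub>0\<close>; if the two intervals are disjoint, it vanishes.  In all other
  cases a bound independent of \<open>L\<close> suffices.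
\<close>

lemma indicator_coefficients:
  fixes \<phi> :: "real \<Rightarrow> complex ^ 'r"
  assumes sq: "\<And>i. square_integrable (\<lambda>x. \<phi> x $ i)" and supp: "\<forall>x. \<bar>x\<bar> > real R \<longrightarrow> \<phi> x = 0"
    and int: "\<And>i. integrable lborel (\<lambda>x. \<phi> x $ i)"
  defines "coef L p \<equiv> L2_inner (indicator {0..real L}) (two_dir_shift \<phi> p)"
  shows "int R \<le> k \<Longrightarrow> k \<le> int L - int R \<Longrightarrow> coef L (s, k, i) = cnj (LINT x|lborel. \<phi> x $ i)"
    and "k < - int R \<or> k > int L + int R \<Longrightarrow> coef L (s, k, i) = 0"
    and "cmod (coef L (s, k, i)) \<le> (LINT x|lborel. cmod (\<phi> x $ i))"
proof -
  let ?e = "two_dir_shift \<phi> (s, k, i)"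
  have far: "?e x = 0" if "\<bar>x - of_int k\<bar> > real R" for x
    using that supp[rule_format, of "x - of_int k"] supp[rule_format, of "of_int k - x"]
    by (simp add: two_dir_shift_def abs_minus_commute)
  have e: "coef L (s, k, i) = cnj (LINT x|lborel. indicator {0..real L} x * ?e x)"
    unfolding coef_def L2_inner_def Bochner_Integration.integral_cnj[symmetric]
    by (intro Bochner_Integration.integral_cong) (simp_all add: indicator_def)
  {
    assume k: "int R \<le> k" "k \<le> int L - int R"
    have "indicator {0..real L} x * ?e x = ?e x" for x
    proof (cases "x \<in> {0..real L}")
      case False
      then have "\<bar>x - of_int k\<bar> > real R" using k by auto
      then show ?thesis by (simp add: far)
    qed simp
    then have "(\<lambda>x. indicator {0..real L} x * ?e x) = ?e" by (rule ext)
    then show "coef L (s, k, i) = cnj (LINT x|lborel. \<phi> x $ i)"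
      unfolding e using two_dir_shift_integral[of "\<lambda>z. z" \<phi> s k i] by simp
  }
  {
    assume k: "k < - int R \<or> k > int L + int R"
    have "indicator {0..real L} x * ?e x = 0" for x
    proof (cases "x \<in> {0..real L}")
      case True
      then have "\<bar>x - of_int k\<bar> > real R" using k by auto
      then show ?thesis by (simp add: far)
    qed simp
    then show "coef L (s, k, i) = 0" unfolding e by (simp only: integral_zero complex_cnj_zero)
  }
  have ie: "integrable lborel (\<lambda>x. ?e x)"
    using lborel_integrable_real_affine[OF int[of i], of 1 "- of_int k"]
      lborel_integrable_real_affine[OF int[of i], of "-1" "of_int k"]
    by (cases s) (simp_all add: two_dir_shift_def)
  have "cmod (coef L (s, k, i)) \<le> (LINT x|lborel. cmod (indicator {0..real L} x * ?e x))"
    unfolding e by (simp add: integral_norm_bound)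
  also have "\<dots> \<le> (LINT x|lborel. cmod (?e x))"
  proof (rule integral_mono)
    show "integrable lborel (\<lambda>x. cmod (indicator {0..real L} x * ?e x))"
    proof (rule integrable_norm)
      have "(\<lambda>x. indicator {0..real L} x *\<^sub>R ?e x) = (\<lambda>x. indicator {0..real L} x * ?e x)"
        by (auto simp: indicator_def)
      then show "integrable lborel (\<lambda>x. indicator {0..real L} x * ?e x)"
        using integrable_mult_indicator[OF _ ie, of "{0..real L}"] by simp
    qed
    show "integrable lborel (\<lambda>x. cmod (?e x))" using ie by simp
    show "cmod (indicator {0..real L} x * ?e x) \<le> cmod (?e x)" for x
      by (simp add: indicator_def)
  qed
  also have "\<dots> = (LINT x|lborel. cmod (\<phi> x $ i))"
    by (rule two_dir_shift_integral)
  finally show "cmod (coef L (s, k, i)) \<le> (LINT x|lborel. cmod (\<phi> x $ i))" .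
qed

section \<open>Normalization of the zeroth moment\<close>

lemma sum_over_index_box:
  fixes g :: "'r :: finite \<Rightarrow> real" and K :: "int set"
  shows "(\<Sum>(s, k, i)\<in>(UNIV :: bool set) \<times> K \<times> UNIV. g i) = 2 * real (card K) * (\<Sum>i\<in>UNIV. g i)"
proof -
  have "(\<Sum>(s, k, i)\<in>(UNIV :: bool set) \<times> K \<times> UNIV. g i) = (\<Sum>s\<in>(UNIV :: bool set). \<Sum>k\<in>K. \<Sum>i\<in>UNIV. g i)"
    by (simp only: sum.cartesian_product)
  then show ?thesis by (simp add: UNIV_bool)
qed

lemma integral_norm_indicator_square:
  "(LINT x|lborel. (cmod (indicator {0..real L} x))\<^sup>2) = real L"
proof -
  have "(\<lambda>x. (cmod (indicator {0..real L} x))\<^sup>2) = indicat_real {0..real L}"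
    by (auto simp: indicator_def fun_eq_iff)
  then show ?thesis by simp
qed

text \<open>
  The squared coefficients of the indicator of \<open>[0, L]\<close> contribute \<open>2 S\<close> for each of the
  \<open>L - 2 R + 1\<close> values of \<open>k\<close> whose translates fit into the interval; the factor \<open>2\<close> counts the two
  directions.  The \<open>4 R\<close> values of \<open>k\<close> at the two ends contribute at most \<open>2 C\<close> each.  The first
  claim is Bessel's inequality for the translates that fit; the second says that no combination
  of translates is closer to the indicator than all the coefficients together permit.
\<close>

lemma moment_zero_bounds:
  fixes \<phi> :: "real \<Rightarrow> complex ^ 'r"
  assumes sq: "\<And>i. square_integrable (\<lambda>x. \<phi> x $ i)" and supp: "\<forall>x. \<bar>x\<bar> > real R \<longrightarrow> \<phi> x = 0"
    and int: "\<And>i. integrable lborel (\<lambda>x. \<phi> x $ i)" and orth: "two_dir_orthogonal \<phi>"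
    and L: "2 * R \<le> L"
  defines "S \<equiv> \<Sum>i\<in>UNIV. (cmod (LINT x|lborel. \<phi> x $ i))\<^sup>2"
    and "C \<equiv> \<Sum>i\<in>UNIV. (LINT x|lborel. cmod (\<phi> x $ i))\<^sup>2"
  shows "2 * (real L - 2 * real R + 1) * S \<le> real L"
    and "finite I \<Longrightarrow> real L - (LINT x|lborel.
         (cmod (indicator {0..real L} x - (\<Sum>p\<in>I. a p * two_dir_shift \<phi> p x)))\<^sup>2)
       \<le> 2 * (real L - 2 * real R + 1) * S + 8 * real R * C"
proof -
  let ?f = "indicator {0..real L} :: real \<Rightarrow> complex"
  define b where "b p = (cmod (L2_inner ?f (two_dir_shift \<phi> p)))\<^sup>2" for p
  define inside where "inside = {int R..int L - int R}"
  define edge where "edge = {- int R..int L + int R} - inside"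
  have b_nonneg: "0 \<le> b p" for p by (simp add: b_def)
  have coef: "int R \<le> k \<Longrightarrow> k \<le> int L - int R \<Longrightarrow> b (s, k, i) = (cmod (LINT x|lborel. \<phi> x $ i))\<^sup>2"
    "k < - int R \<or> k > int L + int R \<Longrightarrow> b (s, k, i) = 0"
    "b (s, k, i) \<le> (LINT x|lborel. cmod (\<phi> x $ i))\<^sup>2" for s k i
    using indicator_coefficients[OF sq supp int, where L = L and s = s and k = k and i = i]
    by (auto simp: b_def intro!: power_mono)
  have card_inside: "real (card inside) = real L - 2 * real R + 1"
    using L by (simp add: inside_def)
  have card_edge: "real (card edge) = 4 * real R"
  proof -
    have "card edge = card {- int R..int L + int R} - card inside"
      unfolding edge_def by (rule card_Diff_subset) (auto simp: inside_def)
    then show ?thesis using L by (simp add: inside_def)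
  qed
  have inside_sum: "(\<Sum>p\<in>UNIV \<times> inside \<times> UNIV. b p) = 2 * (real L - 2 * real R + 1) * S"
  proof -
    have "(\<Sum>p\<in>UNIV \<times> inside \<times> UNIV. b p) =
        (\<Sum>(s, k, i)\<in>(UNIV :: bool set) \<times> inside \<times> UNIV. (cmod (LINT x|lborel. \<phi> x $ i))\<^sup>2)"
      by (intro sum.cong refl) (auto simp: inside_def coef(1))
    then show ?thesis unfolding sum_over_index_box card_inside S_def .
  qed
  have dist: "(LINT x|lborel. (cmod (?f x - (\<Sum>p\<in>I. c p * two_dir_shift \<phi> p x)))\<^sup>2) =
      real L - (\<Sum>p\<in>I. b p) + (\<Sum>p\<in>I. (cmod (c p - L2_inner ?f (two_dir_shift \<phi> p)))\<^sup>2)"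
    if "finite I" for I c
    unfolding b_def using L2_distance_to_combination[OF that square_integrable_indicator
        two_dir_shift_square_integrable[OF sq] two_dir_shift_orthonormal[OF orth]]
    by (simp only: integral_norm_indicator_square)
  have "0 \<le> (LINT x|lborel. (cmod (?f x - (\<Sum>p\<in>UNIV \<times> inside \<times> UNIV.
      L2_inner ?f (two_dir_shift \<phi> p) * two_dir_shift \<phi> p x)))\<^sup>2)"
    by simp
  also have "\<dots> = real L - (\<Sum>p\<in>UNIV \<times> inside \<times> UNIV. b p)"
    by (subst dist) (simp_all add: inside_def)
  finally have "0 \<le> real L - (\<Sum>p\<in>UNIV \<times> inside \<times> UNIV. b p)" .
  then show "2 * (real L - 2 * real R + 1) * S \<le> real L" unfolding inside_sum by simp
  assume I: "finite I"
  have "real L - (LINT x|lborel. (cmod (?f x - (\<Sum>p\<in>I. a p * two_dir_shift \<phi> p x)))\<^sup>2) \<le> (\<Sum>p\<in>I. b p)"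
    unfolding dist[OF I] by (simp add: sum_nonneg)
  also have "(\<Sum>p\<in>I. b p) \<le> (\<Sum>p\<in>UNIV \<times> (inside \<union> edge) \<times> UNIV. b p)"
  proof -
    have zero: "b p = 0" if "p \<notin> UNIV \<times> (inside \<union> edge) \<times> UNIV" for p
    proof (cases p)
      case (fields s k i)
      then show ?thesis using that by (auto simp: edge_def intro!: coef(2))
    qed
    have "(\<Sum>p\<in>I. b p) = (\<Sum>p\<in>I \<inter> (UNIV \<times> (inside \<union> edge) \<times> UNIV). b p)"
      using I zero by (intro sum.mono_neutral_right) auto
    also have "\<dots> \<le> (\<Sum>p\<in>UNIV \<times> (inside \<union> edge) \<times> UNIV. b p)"
      by (intro sum_mono2) (auto simp: inside_def edge_def b_nonneg)
    finally show ?thesis .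
  qed
  also have "\<dots> = (\<Sum>p\<in>UNIV \<times> inside \<times> UNIV. b p) + (\<Sum>p\<in>UNIV \<times> edge \<times> UNIV. b p)"
  proof -
    have "UNIV \<times> (inside \<union> edge) \<times> UNIV =
        (UNIV \<times> inside \<times> UNIV) \<union> ((UNIV \<times> edge \<times> UNIV) :: (bool \<times> int \<times> 'r) set)"
      by auto
    then show ?thesis
      by (simp only:) (intro sum.union_disjoint, auto simp: inside_def edge_def)
  qed
  also have "(\<Sum>p\<in>UNIV \<times> edge \<times> UNIV. b p) \<le>
      (\<Sum>(s, k, i)\<in>(UNIV :: bool set) \<times> edge \<times> UNIV. (LINT x|lborel. cmod (\<phi> x $ i))\<^sup>2)"
    by (intro sum_mono) (auto simp: coef(3))
  also have "\<dots> = 8 * real R * C"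
    unfolding sum_over_index_box card_edge C_def by simp
  finally show "real L - (LINT x|lborel. (cmod (?f x - (\<Sum>p\<in>I. a p * two_dir_shift \<phi> p x)))\<^sup>2)
      \<le> 2 * (real L - 2 * real R + 1) * S + 8 * real R * C"
    unfolding inside_sum by simp
qed

text \<open>
  Divide the bounds of \<open>moment_zero_bounds\<close> by \<open>L\<close> and let \<open>L\<close> grow; there \<open>S\<close> is \<open>\<bar>m\<^sub>0\<bar>\<^sup>2\<close>.  The
  first bound gives \<open>2 S \<le> 1\<close>.  In the second, \<open>indicator_approximation\<close> makes the squared distance
  an arbitrarily small multiple of \<open>L\<close>, which gives \<open>1 \<le> 2 S\<close>.
\<close>

lemma moment_zero_normalization:
  fixes \<phi> :: "real \<Rightarrow> complex ^ 'r"
  assumes mra: "generates_MRA d \<phi>" and d: "d \<ge> 2" and orth: "two_dir_orthogonal \<phi>"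
    and supp: "compact_support \<phi>" and cont: "continuous_on UNIV \<phi>"
  shows "(\<Sum>i\<in>UNIV. (cmod (cont_moment \<phi> 0 $ i))\<^sup>2) = 1 / 2"
proof -
  obtain R :: nat where R: "\<forall>x. \<bar>x\<bar> > real R \<longrightarrow> \<phi> x = 0"
    using compact_support_bound[OF supp] by blast
  have sq: "square_integrable (\<lambda>x. \<phi> x $ i)" for i
    using mra unfolding generates_MRA_def by blast
  have int\<phi>: "integrable lborel \<phi>"
    using moment_integrable[OF cont supp, of 0] by simp
  have int: "integrable lborel (\<lambda>x. \<phi> x $ i)" for i
    by (rule integrable_bounded_linear[OF bounded_linear_vec_nth int\<phi>])
  have comp: "cont_moment \<phi> 0 $ i = (LINT x|lborel. \<phi> x $ i)" for i
    unfolding cont_moment_def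
    using integral_bounded_linear[OF bounded_linear_vec_nth int\<phi>, of i] by simp
  define S where "S = (\<Sum>i\<in>UNIV. (cmod (LINT x|lborel. \<phi> x $ i))\<^sup>2)"
  define C where "C = (\<Sum>i\<in>UNIV. (LINT x|lborel. cmod (\<phi> x $ i))\<^sup>2)"
  note bounds = moment_zero_bounds[OF sq R int orth, folded S_def C_def]
  have S: "0 \<le> S" by (simp add: S_def sum_nonneg)
  have C: "0 \<le> C" by (simp add: C_def sum_nonneg)
  have "2 * S \<le> 1"
  proof (rule ccontr)
    \<comment> \<open>From \<open>2 (L - 2 R + 1) S \<le> L\<close> one gets \<open>L (2 S - 1) \<le> 4 R S\<close>, which fails for large \<open>L\<close>.\<close>
    assume "\<not> 2 * S \<le> 1"
    then obtain L0 :: nat where L0: "real L0 * (2 * S - 1) > 4 * real R * S"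
      using reals_Archimedean3[of "2 * S - 1"] by auto
    define L where "L = max L0 (2 * R)"
    have "real L0 * (2 * S - 1) \<le> real L * (2 * S - 1)"
      using \<open>\<not> 2 * S \<le> 1\<close> by (intro mult_right_mono) (auto simp: L_def)
    moreover have "2 * (real L - 2 * real R + 1) * S \<le> real L"
      by (rule bounds(1)) (simp_all add: L_def)
    ultimately show False using L0 S by (simp add: algebra_simps)
  qed
  moreover have "1 \<le> 2 * S"
  proof (rule ccontr)
    assume neg: "\<not> 1 \<le> 2 * S"
    define \<delta> where "\<delta> = (1 - 2 * S) / 2"
    have \<delta>: "\<delta> > 0" "2 * S = 1 - 2 * \<delta>" using neg by (simp_all add: \<delta>_def field_simps)
    obtain N0 :: nat where N0: "real N0 * \<delta> > 2 * S + 8 * real R * C"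
      using reals_Archimedean3[OF \<delta>(1)] by auto
    \<comment> \<open>With \<open>\<epsilon> = sqrt (\<delta> / 4)\<close> the squared distance is at most \<open>\<delta> L\<close>, half of the gap
      \<open>(1 - 2 S) L\<close>; the other half outgrows the contribution of the ends.\<close>
    have "sqrt (\<delta> / 4) > 0" using \<delta> by simp
    from indicator_approximation[OF mra d this, of "max N0 (2 * R)"]
    obtain n I a where n: "n \<ge> max N0 (2 * R)" and I: "finite I"
      and approx: "(LINT x|lborel. (cmod (indicator {0..real d ^ n} x -
        (\<Sum>p\<in>I. a p * two_dir_shift \<phi> p x)))\<^sup>2) \<le> 4 * (sqrt (\<delta> / 4))\<^sup>2 * real d ^ n"
      by blast
    define L where "L = d ^ n"
    have "n < L" using power_gt_expt[of d n] d by (simp add: L_def)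
    then have L: "2 * R \<le> L" "N0 \<le> L" using n by auto
    have "(LINT x|lborel. (cmod (indicator {0..real L} x -
        (\<Sum>p\<in>I. a p * two_dir_shift \<phi> p x)))\<^sup>2) \<le> \<delta> * real L"
      using approx \<delta> by (simp add: L_def)
    moreover have "2 * (real L - 2 * real R + 1) * S = (real L - 2 * real R + 1) * (2 * S)"
      by simp
    ultimately have "real L - \<delta> * real L \<le> (real L - 2 * real R + 1) * (2 * S) + 8 * real R * C"
      using bounds(2)[OF L(1) I, of a] by linarith
    also have "\<dots> \<le> (real L + 1) * (2 * S) + 8 * real R * C"
      using S by (intro add_right_mono mult_right_mono) auto
    also have "\<dots> = real L * (1 - 2 * \<delta>) + 2 * S + 8 * real R * C"
      unfolding \<delta>(2)[symmetric] by (simp add: algebra_simps)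
    finally have "real L * \<delta> \<le> 2 * S + 8 * real R * C" by (simp add: algebra_simps)
    moreover have "real N0 * \<delta> \<le> real L * \<delta>"
      using L(2) \<delta>(1) by (intro mult_right_mono) auto
    ultimately show False using N0 by simp
  qed
  ultimately show ?thesis by (simp add: comp S_def)
qed

section \<open>Recursive computation of the moments\<close>

text \<open>
  The moment formula for the refinement equation contains \<open>m\<^sub>j\<close> on both sides, on the right in the
  term \<open>l = j\<close>.  Moving that term to the left leaves a linear system with the matrix \<open>T\<close>, which
  Condition E makes invertible, since \<open>d ^ j > 1\<close>.
\<close>

lemma moment_recursion_solved:
  fixes \<phi> :: "real \<Rightarrow> complex ^ 'r"
  assumes "d \<ge> 2" and ms: "two_dir_multiscaling d Pp Pm \<phi>"
    and "compact_support \<phi>" and "continuous_on UNIV \<phi>" and "condition_E d Pp Pm" and j: "j \<ge> 1"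
  defines "T \<equiv> mat (real d ^ j)
          - (discrete_moment d Pp 0 + (-1) ^ j *\<^sub>R discrete_moment d Pm 0)"
  shows "invertible T"
    and "cont_moment \<phi> j = cmat (matrix_inv T) *v
          (\<Sum>l<j. real (j choose l) *\<^sub>R
             (cmat (discrete_moment d Pp (j - l) + (-1) ^ l *\<^sub>R discrete_moment d Pm (j - l))
                *v cont_moment \<phi> l))"
proof -
  have fin: "finitely_supported Pp" "finitely_supported Pm"
    and refine: "\<phi> = two_dir_comb d Pp Pm \<phi>"
    using ms unfolding two_dir_multiscaling_def by auto
  show inv: "invertible T"
    unfolding T_def
  proof (rule condition_E_invertible[OF fin \<open>condition_E d Pp Pm\<close>])
    show "1 < real d ^ j" using \<open>d \<ge> 2\<close> j by (intro one_less_power) auto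
    show "(-1) ^ j * (-1) ^ j = (1 :: real)" by (simp flip: power_mult_distrib)
  qed
  define A where "A l = cmat (discrete_moment d Pp (j - l) + (-1) ^ l *\<^sub>R discrete_moment d Pm (j - l))" for l
  define w where "w = (\<Sum>l<j. real (j choose l) *\<^sub>R (A l *v cont_moment \<phi> l))"
  have "cont_moment \<phi> j = (1 / real d ^ j) *\<^sub>R (\<Sum>l\<le>j. real (j choose l) *\<^sub>R (A l *v cont_moment \<phi> l))"
    unfolding A_def using moment_two_dir_comb[OF assms(4,3) _ fin, of d j] \<open>d \<ge> 2\<close> refine[symmetric] by simp
  also have "(\<Sum>l\<le>j. real (j choose l) *\<^sub>R (A l *v cont_moment \<phi> l)) = w + A j *v cont_moment \<phi> j"
    by (simp add: w_def lessThan_Suc_atMost[symmetric])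
  finally have "real d ^ j *\<^sub>R cont_moment \<phi> j = real d ^ j *\<^sub>R ((1 / real d ^ j) *\<^sub>R (w + A j *v cont_moment \<phi> j))"
    by (rule arg_cong)
  then have "real d ^ j *\<^sub>R cont_moment \<phi> j = w + A j *v cont_moment \<phi> j"
    using \<open>d \<ge> 2\<close> by simp
  moreover have "cmat T *v cont_moment \<phi> j = real d ^ j *\<^sub>R cont_moment \<phi> j - A j *v cont_moment \<phi> j"
  proof -
    have "mat (complex_of_real c) *v v = c *\<^sub>R v" for c and v :: "complex ^ 'r"
      unfolding vec_eq_iff
      by (simp add: matrix_vector_mult_def mat_def if_distrib[of "\<lambda>x. x * _"] cong: if_cong)
        (simp add: scaleR_conv_of_real)
    then show ?thesis
      unfolding T_def A_def cmat_diff cmat_mat matrix_vector_mult_diff_rdistrib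
      by (simp del: of_real_power of_real_of_nat_eq)
  qed
  ultimately have "cmat T *v cont_moment \<phi> j = w" by simp
  then have "cont_moment \<phi> j = cmat (matrix_inv T) *v w"
    by (rule matrix_inv_solve[OF inv])
  then show "cont_moment \<phi> j = cmat (matrix_inv T) *v
          (\<Sum>l<j. real (j choose l) *\<^sub>R
             (cmat (discrete_moment d Pp (j - l) + (-1) ^ l *\<^sub>R discrete_moment d Pm (j - l))
                *v cont_moment \<phi> l))"
    unfolding w_def A_def .
qed

theorem theorem4p2:
  fixes d :: nat
    and \<phi> :: "real \<Rightarrow> complex ^ 'r"
    and \<psi> :: "nat \<Rightarrow> real \<Rightarrow> complex ^ 'r"
    and Pp Pm :: "int \<Rightarrow> real ^ 'r ^ 'r"
    and Qp Qm :: "nat \<Rightarrow> int \<Rightarrow> real ^ 'r ^ 'r"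
  assumes "d \<ge> 2"
    and "two_dir_multiscaling d Pp Pm \<phi>"
    and "two_dir_multiwavelets d \<phi> Qp Qm \<psi>"
    and "two_dir_orthogonal \<phi>"
    and "compact_support \<phi>"
    and "continuous_on UNIV \<phi>"
    and "condition_E d Pp Pm"
  shows
    "cont_moment \<phi> 0 =
       cmat (discrete_moment d Pp 0 + discrete_moment d Pm 0) *v cont_moment \<phi> 0 \<and>
     (\<Sum>i\<in>UNIV. cnj (cont_moment \<phi> 0 $ i) * cont_moment \<phi> 0 $ i) = 1 / 2 \<and>
     (\<forall>j\<ge>1.
        invertible (mat (real d ^ j)
          - (discrete_moment d Pp 0 + (-1) ^ j *\<^sub>R discrete_moment d Pm 0)) \<and>
        cont_moment \<phi> j =
          cmat (matrix_inv (mat (real d ^ j)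
            - (discrete_moment d Pp 0 + (-1) ^ j *\<^sub>R discrete_moment d Pm 0))) *v
          (\<Sum>l<j. real (j choose l) *\<^sub>R
             (cmat (discrete_moment d Pp (j - l) + (-1) ^ l *\<^sub>R discrete_moment d Pm (j - l))
                *v cont_moment \<phi> l))) \<and>
     (\<forall>s\<in>{1..d - 1}. \<forall>j.
        cont_moment (\<psi> s) j =
          (1 / real d ^ j) *\<^sub>R
          (\<Sum>l\<le>j. real (j choose l) *\<^sub>R
             (cmat (discrete_moment d (Qp s) (j - l)
                + (-1) ^ l *\<^sub>R discrete_moment d (Qm s) (j - l))
                *v cont_moment \<phi> l))) \<and>
     (\<forall>\<mu> \<nu>.
        \<mu> 0 = cont_moment \<phi> 0 \<and>
        (\<forall>j\<ge>1. \<mu> j =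
          cmat (matrix_inv (mat (real d ^ j)
            - (discrete_moment d Pp 0 + (-1) ^ j *\<^sub>R discrete_moment d Pm 0))) *v
          (\<Sum>l<j. real (j choose l) *\<^sub>R
             (cmat (discrete_moment d Pp (j - l) + (-1) ^ l *\<^sub>R discrete_moment d Pm (j - l))
                *v \<mu> l))) \<and>
        (\<forall>s\<in>{1..d - 1}. \<forall>j. \<nu> s j =
          (1 / real d ^ j) *\<^sub>R
          (\<Sum>l\<le>j. real (j choose l) *\<^sub>R
             (cmat (discrete_moment d (Qp s) (j - l)
                + (-1) ^ l *\<^sub>R discrete_moment d (Qm s) (j - l))
                *v \<mu> l))) \<longrightarrow>
        (\<forall>j. \<mu> j = cont_moment \<phi> j) \<and>
        (\<forall>s\<in>{1..d - 1}. \<forall>j. \<nu> s j = cont_moment (\<psi> s) j))"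
proof -
  have fin: "finitely_supported Pp" "finitely_supported Pm"
    and refine: "\<phi> = two_dir_comb d Pp Pm \<phi>" and mra: "generates_MRA d \<phi>"
    using assms(2) unfolding two_dir_multiscaling_def by auto
  have d: "d > 0" using \<open>d \<ge> 2\<close> by simp
  note recursion = moment_recursion_solved[OF assms(1,2,5,6,7)]
  have fixed: "cont_moment \<phi> 0 =
      cmat (discrete_moment d Pp 0 + discrete_moment d Pm 0) *v cont_moment \<phi> 0"
    using moment_two_dir_comb[OF assms(6,5) d fin, of 0] refine[symmetric] by simp
  have "(\<Sum>i\<in>UNIV. cnj (cont_moment \<phi> 0 $ i) * cont_moment \<phi> 0 $ i) =
      complex_of_real (\<Sum>i\<in>UNIV. (cmod (cont_moment \<phi> 0 $ i))\<^sup>2)"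
    by (simp add: complex_norm_square mult.commute del: of_real_power)
  then have normalized: "(\<Sum>i\<in>UNIV. cnj (cont_moment \<phi> 0 $ i) * cont_moment \<phi> 0 $ i) = 1 / 2"
    using moment_zero_normalization[OF mra assms(1,4,5,6)] by simp
  have wavelets: "cont_moment (\<psi> s) j =
          (1 / real d ^ j) *\<^sub>R
          (\<Sum>l\<le>j. real (j choose l) *\<^sub>R
             (cmat (discrete_moment d (Qp s) (j - l)
                + (-1) ^ l *\<^sub>R discrete_moment d (Qm s) (j - l))
                *v cont_moment \<phi> l))" if s: "s \<in> {1..d - 1}" for s j
  proof -
    have "finitely_supported (Qp s)" "finitely_supported (Qm s)" "\<psi> s = two_dir_comb d (Qp s) (Qm s) \<phi>"
      using assms(3) s unfolding two_dir_multiwavelets_def by auto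
    then show ?thesis using moment_two_dir_comb[OF assms(6,5) d, of "Qp s" "Qm s" j] by simp
  qed
  have unique: "(\<forall>j. \<mu> j = cont_moment \<phi> j) \<and>
        (\<forall>s\<in>{1..d - 1}. \<forall>j. \<nu> s j = cont_moment (\<psi> s) j)"
    if "\<mu> 0 = cont_moment \<phi> 0"
      and step: "\<forall>j\<ge>1. \<mu> j =
          cmat (matrix_inv (mat (real d ^ j)
            - (discrete_moment d Pp 0 + (-1) ^ j *\<^sub>R discrete_moment d Pm 0))) *v
          (\<Sum>l<j. real (j choose l) *\<^sub>R
             (cmat (discrete_moment d Pp (j - l) + (-1) ^ l *\<^sub>R discrete_moment d Pm (j - l))
                *v \<mu> l))"
      and \<nu>: "\<forall>s\<in>{1..d - 1}. \<forall>j. \<nu> s j =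
          (1 / real d ^ j) *\<^sub>R
          (\<Sum>l\<le>j. real (j choose l) *\<^sub>R
             (cmat (discrete_moment d (Qp s) (j - l)
                + (-1) ^ l *\<^sub>R discrete_moment d (Qm s) (j - l))
                *v \<mu> l))" for \<mu> \<nu>
  proof -
    have \<mu>: "\<mu> j = cont_moment \<phi> j" for j
    proof (induction j rule: less_induct)
      case (less j)
      show ?case
      proof (cases "j = 0")
        case True
        then show ?thesis using that(1) by simp
      next
        case False
        then have j: "j \<ge> 1" by simp
        show ?thesis
          unfolding step[rule_format, OF j] recursion(2)[OF j]
          by (intro arg_cong[where f = "(*v) _"] sum.cong refl) (simp add: less)
      qed
    qed
    moreover have "\<nu> s j = cont_moment (\<psi> s) j" if "s \<in> {1..d - 1}" for s j
      using \<nu> wavelets[OF that] that by (simp add: \<mu>)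
    ultimately show ?thesis by blast
  qed
  show ?thesis
    using fixed normalized recursion wavelets unique by blast
qed

end
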